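(* For every $n\ge 1$, every integer $k\ge 0$, every partition $\mu\vdash n$ and every permutation $\pi\in S_n$ of cycle type $\mu$, $$\#\{\sigma\in S_n:\ \sigma^k=\pi\}=\sum_{\sigma\in I^k_n\cap U_\mu} (-1)^{|\mathrm{Des}(\sigma)\setminus S(\mu)|},$$ where $I^k_n=\{\sigma\in S_n:\ \sigma^k=1\}$ is the set of $k$-roots of the identity permutation, $U_\mu$ is the set of $\mu$-unimodal permutations in $S_n$, $\mathrm{Des}(\sigma)$ is the descent set of $\sigma$, and $S(\mu)$ is the set of partial sums of $\mu$.
   Context: $S_n$ is the symmetric group on $\{1,\dots,n\}$. The descent set of $\sigma\in S_n$ is $\mathrm{Des}(\sigma)=\{j\in\{1,\dots,n-1\}:\ \sigma(j)>\sigma(j+1)\}$. Let $\mu=(\mu_1,\dots,\mu_t)$ be a partition of $n$ with $t$ nonzero parts (written in weakly decreasing order). Put $\mu_{(0)}:=0$ and $\mu_{(i)}:=\sum_{j=1}^i\mu_j$ for $1\le i\le t$, and let $S(\mu):=\{\mu_{(1)},\dots,\mu_{(t)}\}$. A permutation $\sigma\in S_n$ is $\mu$-unimodal if for every $0\le i<t$ there exists $1\le \ell\le \mu_{i+1}$ such that $$\sigma(\mu_{(i)}+1)>\sigma(\mu_{(i)}+2)>\cdots>\sigma(\mu_{(i)}+\ell)<\sigma(\mu_{(i)}+\ell+1)<\cdots<\sigma(\mu_{(i+1)}),$$ i.e. on each of the consecutive blocks of positions $\mu_{(i)}+1,\dots,\mu_{(i+1)}$ the values of $\sigma$ first decrease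 and then increase (either part may be trivial). The set of $\mu$-unimodal permutations in $S_n$ is denoted $U_\mu$. For $k=0$, $\sigma^0$ is the identity, so $I^0_n=S_n$. *)

theory Defs
  imports "HOL-Combinatorics.Permutations" "HOL-Combinatorics.Orbits" "HOL-Library.Multiset"
begin

text \<open>
  Elements of the symmetric group \<open>S\<^sub>n\<close> are functions \<open>\<sigma> :: nat \<Rightarrow> nat\<close> with
  \<^prop>\<open>\<sigma> permutes {1..n}\<close>, so they are the identity off \<open>{1..n}\<close>; the group power
  \<open>\<sigma>\<^sup>k\<close> is \<^term>\<open>\<sigma> ^^ k\<close>.
\<close>

definition symm_perms :: "nat \<Rightarrow> (nat \<Rightarrow> nat) set" where
  "symm_perms n = {\<sigma>. \<sigma> permutes {1..n}}"

definition identity_roots :: "nat \<Rightarrow> nat \<Rightarrow> (nat \<Rightarrow> nat) set" where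
  "identity_roots n k = {\<sigma> \<in> symm_perms n. \<sigma> ^^ k = id}"

definition descent_set :: "nat \<Rightarrow> (nat \<Rightarrow> nat) \<Rightarrow> nat set" where
  "descent_set n \<sigma> = {j \<in> {1..n - 1}. \<sigma> j > \<sigma> (j + 1)}"

definition integer_partition :: "nat \<Rightarrow> nat list \<Rightarrow> bool" where
  "integer_partition n \<mu> \<longleftrightarrow> sorted_wrt (\<ge>) \<mu> \<and> (\<forall>m \<in> set \<mu>. m > 0) \<and> sum_list \<mu> = n"

text \<open>
  Fixed points contribute orbits of size 1. The orbits form a set, so each cycle is counted once.
\<close>
definition cycle_type :: "nat \<Rightarrow> (nat \<Rightarrow> nat) \<Rightarrow> nat multiset" where
  "cycle_type n \<pi> = image_mset card (mset_set (orbit \<pi> ` {1..n}))"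

definition partial_sum :: "nat list \<Rightarrow> nat \<Rightarrow> nat" where
  "partial_sum \<mu> i = sum_list (take i \<mu>)"

definition partial_sums :: "nat list \<Rightarrow> nat set" where
  "partial_sums \<mu> = partial_sum \<mu> ` {1..length \<mu>}"

text \<open>
  List indices start at 0, so \<open>\<mu> ! i\<close> is the part \<open>\<mu>\<^bsub>i+1\<^esub>\<close>, and the \<open>i\<close>-th block consists of
  the positions \<open>partial_sum \<mu> i + j\<close> with \<open>1 \<le> j \<le> \<mu> ! i\<close>. The chain of inequalities is
  written as one inequality for each pair of adjacent positions.
\<close>
definition unimodal_perms :: "nat \<Rightarrow> nat list \<Rightarrow> (nat \<Rightarrow> nat) set" where
  "unimodal_perms n \<mu> = {\<sigma> \<in> symm_perms n.
     \<forall>i < length \<mu>. \<exists>l \<in> {1..\<mu> ! i}.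
       (\<forall>j \<in> {1..<l}. \<sigma> (partial_sum \<mu> i + j) > \<sigma> (partial_sum \<mu> i + j + 1)) \<and>
       (\<forall>j \<in> {l..<\<mu> ! i}. \<sigma> (partial_sum \<mu> i + j) < \<sigma> (partial_sum \<mu> i + j + 1))}"

end

theory Submission
  imports Defs "HOL-Combinatorics.Cycles" "HOL-Library.List_Lexorder" "HOL-Library.Product_Lexorder"
begin

text \<open>
  Let \<open>S = S(\<mu>)\<close> and let \<open>Y\<^sub>E\<close> be the group of permutations that preserve every prefix \<open>{1..e}\<close>
  with \<open>e \<in> E\<close>. Reading off the sequence of \<open>Y\<^sub>E\<close>-orbits met by \<open>y, \<sigma> y, \<sigma>\<^sup>2 y, \<dots>\<close> and sorting
  these periodic words gives, in the manner of Gessel and Reutenauer,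
  \<open>#{\<sigma>. \<sigma>\<^sup>k \<in> Y\<^sub>E} = |Y\<^sub>E| \<cdot> #{\<tau>. \<tau>\<^sup>k = 1 \<and> Des(\<tau>) \<subseteq> E}\<close>.

  Choose a point \<open>x s\<close> in every block. On the side of the roots \<open>\<tau>\<close> of the identity, the alternating sum
  over all \<open>E \<supseteq> S \<union> Des(\<tau>)\<close> without further elements between \<open>x s\<close> and the end of its block
  vanishes unless the descents of \<open>\<tau>\<close> within each block are exactly the positions before \<open>x s\<close>; so
  summing over \<open>x\<close> yields the signed sum over unimodal roots. On the other side, by the identity above,
  the same expression is an alternating sum over chains of \<open>\<sigma>\<^sup>k\<close>-invariant sets that refine the chain of
  block prefixes and avoid the points \<open>x s\<close>. Toggling the set obtained by removing the \<open>\<sigma>\<^sup>k\<close>-orbit of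
  \<open>x s\<close> from the prefix ending at \<open>s\<close> cancels everything except the \<open>\<sigma>\<close> for which the cycles of
  \<open>\<sigma>\<^sup>k\<close> are the blocks, that is, the roots of certain conjugates of \<open>\<pi>\<close>. The number of these
  conjugates, weighted by the choices of \<open>x\<close>, does not depend on \<open>k\<close>, and the case \<open>k = 1\<close> evaluates it.
\<close>

section \<open>Cancellation in alternating sums, stable sorting, rigidity of sorted
  sequences\<close>

text \<open>Pairing each set that lacks \<open>X\<close> with the set obtained by inserting
  \<open>X\<close> cancels all terms. The toggled \<open>X\<close> will be a position in a set of
  positions and, later, a subset in a chain of subsets.\<close>

lemma sum_alternating_toggle_eq_0:
  assumes "finite F" "\<And>A. A \<in> F \<Longrightarrow> finite A"
    and "\<And>A. A \<in> F \<Longrightarrow> insert X A \<in> F" "\<And>A. A \<in> F \<Longrightarrow> A - {X} \<in> F"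
  shows "(\<Sum>A\<in>F. (- 1) ^ card A) = (0 :: int)"
proof -
  let ?F0 = "{A \<in> F. X \<notin> A}" and ?F1 = "{A \<in> F. X \<in> A}"
  have "(\<Sum>A\<in>?F1. (- 1) ^ card A) = (\<Sum>A\<in>?F0. (- 1 :: int) ^ card (insert X A))"
    by (rule sum.reindex_bij_witness[of _ "insert X" "\<lambda>A. A - {X}"])
       (auto simp: assms insert_absorb)
  also have "\<dots> = - (\<Sum>A\<in>?F0. (- 1) ^ card A)"
    using assms(2) by (simp add: sum_negf)
  finally have "(\<Sum>A\<in>?F0. (- 1) ^ card A) + (\<Sum>A\<in>?F1. (- 1) ^ card A) = (0 :: int)"
    by simp
  moreover have "(\<Sum>A\<in>F. (- 1 :: int) ^ card A) =
      (\<Sum>A\<in>?F0. (- 1) ^ card A) + (\<Sum>A\<in>?F1. (- 1) ^ card A)"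
    by (subst sum.union_disjoint[symmetric]) (use assms(1) in \<open>auto intro!: sum.cong\<close>)
  ultimately show ?thesis by simp
qed

text \<open>Inclusion-exclusion on a Boolean interval: unless the interval is empty or a single
  point, some element of \<open>B - A\<close> can be toggled.\<close>

lemma sum_alternating_interval:
  assumes "finite B"
  shows "(\<Sum>E | A \<subseteq> E \<and> E \<subseteq> B. (- 1) ^ card E) = (if A = B then (- 1) ^ card A else (0 :: int))"
proof (cases "A = B")
  case True
  then have "{E. A \<subseteq> E \<and> E \<subseteq> B} = {A}" by auto
  with True show ?thesis by simp
next
  case False
  show ?thesis
  proof (cases "A \<subseteq> B")
    case True
    with False obtain b where b: "b \<in> B" "b \<notin> A" by auto
    have "finite {E. A \<subseteq> E \<and> E \<subseteq> B}"
      by (rule finite_subset[of _ "Pow B"]) (use assms in auto)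
    then have "(\<Sum>E | A \<subseteq> E \<and> E \<subseteq> B. (- 1) ^ card E) = (0 :: int)"
      by (rule sum_alternating_toggle_eq_0[where X = b])
        (use b assms finite_subset in auto)
    with False show ?thesis by simp
  next
    case False
    then have "{E. A \<subseteq> E \<and> E \<subseteq> B} = {}" by auto
    then show ?thesis using \<open>A \<noteq> B\<close> by (simp only: sum.empty if_False)
  qed
qed

text \<open>Sorting the pairs \<open>(key y, y)\<close> lexicographically breaks ties by position;
  \<open>h i\<close> is the element that lands in place \<open>i\<close>. Lists are indexed from 0,
  so place \<open>i\<close> is entry \<open>i - 1\<close>.\<close>

lemma stable_sort_permutation:
  fixes key :: "nat \<Rightarrow> 'a::linorder"
  obtains h where "h permutes {1..n}"
    "\<And>i j. 1 \<le> i \<Longrightarrow> i < j \<Longrightarrow> j \<le> n \<Longrightarrow>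
      key (h i) < key (h j) \<or> key (h i) = key (h j) \<and> h i < h j"
proof -
  let ?P = "(\<lambda>y. (key y, y)) ` {1..n}"
  define xs where "xs = sorted_list_of_set ?P"
  have fin: "finite ?P" by simp
  have card: "card ?P = n" by (subst card_image) (auto simp: inj_on_def)
  have len: "length xs = n" unfolding xs_def using card by simp
  have set: "set xs = ?P" unfolding xs_def using fin by simp
  have dist: "distinct xs" unfolding xs_def by simp
  have sorted: "sorted_wrt (<) xs" unfolding xs_def by simp
  define h where "h i = (if i \<in> {1..n} then snd (xs ! (i - 1)) else i)" for i
  have nth: "xs ! (i - 1) = (key (h i), h i) \<and> h i \<in> {1..n}" if "i \<in> {1..n}" for i
  proof -
    have "xs ! (i - 1) \<in> ?P"
      unfolding set[symmetric] by (rule nth_mem) (use that len in auto)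
    then show ?thesis using that unfolding h_def by auto
  qed
  have inj: "inj_on h {1..n}"
  proof (rule inj_onI)
    fix i j assume ij: "i \<in> {1..n}" "j \<in> {1..n}" "h i = h j"
    then have "xs ! (i - 1) = xs ! (j - 1)" using nth by metis
    then have "i - 1 = j - 1" using dist len ij by (subst (asm) nth_eq_iff_index_eq) auto
    then show "i = j" using ij by auto
  qed
  have "h ` {1..n} \<subseteq> {1..n}" using nth by auto
  then have "bij_betw h {1..n} {1..n}" using inj by (simp add: bij_betw_def endo_inj_surj)
  then have perm: "h permutes {1..n}"
    by (rule bij_imp_permutes) (auto simp: h_def)
  have "key (h i) < key (h j) \<or> key (h i) = key (h j) \<and> h i < h j"
    if "1 \<le> i" "i < j" "j \<le> n" for i j
  proof -
    have "xs ! (i - 1) < xs ! (j - 1)"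
      using sorted that len by (simp add: sorted_wrt_iff_nth_less)
    then have "(key (h i), h i) < (key (h j), h j)" using nth[of i] nth[of j] that by auto
    then show ?thesis by (auto simp: less_prod_def')
  qed
  with perm show ?thesis using that by blast
qed

text \<open>The permutation \<open>g\<close> shows that \<open>V\<close> and \<open>W\<close> take
  the same values with the same multiplicities, and a weakly increasing sequence is determined by
  its multiset of values.\<close>

lemma rearranged_mono_on_eq:
  fixes V W :: "nat \<Rightarrow> 'a::linorder"
  assumes "g permutes {1..n}" "\<And>y. y \<in> {1..n} \<Longrightarrow> V y = W (g y)"
    and "mono_on {1..n} V" "mono_on {1..n} W" "y \<in> {1..n}"
  shows "V y = W y"
proof -
  have sorted: "sorted (map U [1..<Suc n])" if "mono_on {1..n} U" for U :: "nat \<Rightarrow> 'a"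
    unfolding sorted_map
    by (rule sorted_wrt_mono_rel[OF _ sorted_upt]) (use that in \<open>auto simp: mono_on_def\<close>)
  have set: "mset [1..<Suc n] = mset_set {1..n}"
    by (simp only: mset_upt atLeastLessThanSuc_atLeastAtMost)
  have "image_mset V (mset_set {1..n}) = image_mset (W \<circ> g) (mset_set {1..n})"
    by (rule image_mset_cong) (use assms(2) in auto)
  also have "\<dots> = image_mset W (mset_set {1..n})"
    using assms(1) by (simp add: image_mset.comp permutes_image_mset
      flip: multiset.map_comp)
  finally have "mset (map V [1..<Suc n]) = mset (map W [1..<Suc n])"
    by (simp only: mset_map set)
  then have "sort (map V [1..<Suc n]) = sort (map W [1..<Suc n])"
    by (metis sorted_list_of_multiset_mset)
  then have "map V [1..<Suc n] = map W [1..<Suc n]"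
    using sorted[OF assms(3)] sorted[OF assms(4)] by (simp only: sorted_sort_id)
  then show ?thesis using assms(5) by (metis atLeastAtMost_iff atLeastLessThan_iff le_imp_less_Suc map_eq_conv set_upt)
qed

text \<open>A finite chain has only the trivial order automorphism. Concretely, the image and the
  preimage of the least moved point both exceed it, which contradicts monotonicity on its
  fibre.\<close>

lemma permutes_strict_mono_on_fibres_eq_id:
  fixes \<psi> :: "nat \<Rightarrow> nat"
  assumes "\<psi> permutes {1..n}" "\<And>y. y \<in> {1..n} \<Longrightarrow> W (\<psi> y) = W y"
    and mono: "\<And>y z. y \<in> {1..n} \<Longrightarrow> z \<in> {1..n} \<Longrightarrow> y < z \<Longrightarrow> W y = W z \<Longrightarrow> \<psi> y < \<psi> z"
  shows "\<psi> = id"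
proof (rule ccontr)
  assume "\<psi> \<noteq> id"
  then have ex: "\<exists>y. \<psi> y \<noteq> y" by (auto simp: fun_eq_iff)
  define y where "y = (LEAST y. \<psi> y \<noteq> y)"
  have y: "\<psi> y \<noteq> y" unfolding y_def using ex by (rule LeastI_ex)
  have less: "\<psi> z = z" if "z < y" for z using that not_less_Least unfolding y_def by blast
  have inj: "inj \<psi>" using assms(1) by (rule permutes_inj)
  have yn: "y \<in> {1..n}" using y assms(1) by (metis permutes_not_in)
  have gt: "y < \<psi> y" using y less inj by (metis injD linorder_neqE_nat)
  obtain z where z: "\<psi> z = y" using assms(1) by (metis permutes_inverses(1))
  have zn: "z \<in> {1..n}" using z yn assms(1) by (metis permutes_in_image)
  have "z > y" using less z y by (metis linorder_neqE_nat)
  then have "\<psi> y < \<psi> z" using mono[OF yn zn] assms(2)[OF zn] z by simp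
  with z gt show False by simp
qed

section \<open>Roots with prescribed descents, encoded by words of levels\<close>

lemma conjugate_funpow:
  assumes "bij g"
  shows "(inv g \<circ> f \<circ> g) ^^ j = inv g \<circ> f ^^ j \<circ> g"
  by (induction j) (use assms in \<open>auto simp: fun_eq_iff bij_is_surj surj_f_inv_f bij_is_inj\<close>)

text \<open>The Young subgroup \<open>Y\<^sub>E\<close>: for \<open>E\<close> inside
  \<open>{1..n}\<close> it preserves each of the intervals into which \<open>{1..n}\<close> is cut
  after the elements of \<open>E\<close>.\<close>

definition prefix_stabilizer :: "nat \<Rightarrow> nat set \<Rightarrow> (nat \<Rightarrow> nat) set" where
  "prefix_stabilizer n E = {g. g permutes {1..n} \<and> (\<forall>e\<in>E. g ` {1..e} = {1..e})}"

text \<open>The number, counted from 0, of the interval that contains \<open>y\<close> when cuts are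
  made after the elements of \<open>E\<close>. The strict inequality keeps a cut point in the
  interval that it ends.\<close>

definition level :: "nat set \<Rightarrow> nat \<Rightarrow> nat" where
  "level E y = card {e \<in> E. e < y}"

text \<open>One period of the itinerary of \<open>y\<close> through these intervals: if
  \<open>\<sigma> ^^ k\<close> lies in \<open>Y\<^sub>E\<close>, the levels met along the orbit of a
  point of \<open>{1..n}\<close> repeat with period \<open>k\<close>.\<close>

definition level_word :: "nat set \<Rightarrow> nat \<Rightarrow> (nat \<Rightarrow> nat) \<Rightarrow> nat \<Rightarrow> nat list" where
  "level_word E k \<sigma> y = map (\<lambda>j. level E ((\<sigma> ^^ j) y)) [0..<k]"

lemma level_mono: "finite E \<Longrightarrow> y \<le> z \<Longrightarrow> level E y \<le> level E z"
  unfolding level_def by (rule card_mono) auto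

lemma level_le_iff:
  assumes "finite E" "e \<in> E"
  shows "level E y \<le> level E e \<longleftrightarrow> y \<le> e"
proof
  assume le: "level E y \<le> level E e"
  show "y \<le> e"
  proof (rule ccontr)
    assume "\<not> y \<le> e"
    then have "insert e {e' \<in> E. e' < e} \<subseteq> {e' \<in> E. e' < y}" using assms(2) by auto
    then have "card (insert e {e' \<in> E. e' < e}) \<le> level E y"
      unfolding level_def by (intro card_mono) (use assms(1) in simp_all)
    then have "level E e < level E y" using assms(1) by (simp add: level_def)
    with le show False by simp
  qed
qed (rule level_mono[OF assms(1)])

lemma level_Suc: "y \<notin> E \<Longrightarrow> level E (Suc y) = level E y"
  unfolding level_def by (rule arg_cong[where f = card]) (auto simp: less_Suc_eq)

text \<open>This turns membership in the Young subgroup into a statement about letters. Levels tell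
  the inside of a prefix from its outside, and an inclusion of the image of a prefix in that prefix
  is an equality by cardinality.\<close>

lemma prefix_stabilizer_iff_level:
  assumes "E \<subseteq> {1..n}" "g permutes {1..n}"
  shows "g \<in> prefix_stabilizer n E \<longleftrightarrow> (\<forall>y\<in>{1..n}. level E (g y) = level E y)"
proof
  assume g: "g \<in> prefix_stabilizer n E"
  show "\<forall>y\<in>{1..n}. level E (g y) = level E y"
  proof
    fix y assume y: "y \<in> {1..n}"
    then have gy: "g y \<in> {1..n}" using assms(2) by (simp only: permutes_in_image)
    have "e < g y \<longleftrightarrow> e < y" if "e \<in> E" for e
    proof -
      have "g ` {1..e} = {1..e}" using g that by (auto simp: prefix_stabilizer_def)
      then have "g y \<in> {1..e} \<longleftrightarrow> y \<in> {1..e}"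
        by (metis assms(2) inj_image_mem_iff permutes_inj)
      then show ?thesis using y gy by auto
    qed
    then show "level E (g y) = level E y"
      unfolding level_def by (intro arg_cong[where f = card]) auto
  qed
next
  assume *: "\<forall>y\<in>{1..n}. level E (g y) = level E y"
  have fin: "finite E" using assms(1) finite_subset by blast
  have "g ` {1..e} = {1..e}" if e: "e \<in> E" for e
  proof (rule card_subset_eq)
    show "g ` {1..e} \<subseteq> {1..e}"
    proof
      fix z assume "z \<in> g ` {1..e}"
      then obtain y where y: "z = g y" "1 \<le> y" "y \<le> e" by auto
      have yn: "y \<in> {1..n}" using y e assms(1) by auto
      then have "z \<in> {1..n}" using y assms(2) by (simp only: permutes_in_image)
      moreover have "level E z \<le> level E e"
        using * yn y level_mono[OF fin y(3)] by simp
      ultimately show "z \<in> {1..e}" using level_le_iff[OF fin e] by auto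
    qed
    show "card (g ` {1..e}) = card {1..e}"
      using assms(2) by (metis card_image inj_on_subset permutes_inj subset_UNIV)
  qed simp
  then show "g \<in> prefix_stabilizer n E" using assms(2) by (auto simp: prefix_stabilizer_def)
qed

lemma finite_prefix_stabilizer: "finite (prefix_stabilizer n E)"
  by (rule finite_subset[OF _ finite_permutations[of "{1..n}"]])
    (auto simp: prefix_stabilizer_def)

lemma length_level_word [simp]: "length (level_word E k \<sigma> y) = k"
  by (simp add: level_word_def)

lemma nth_level_word: "j < k \<Longrightarrow> level_word E k \<sigma> y ! j = level E ((\<sigma> ^^ j) y)"
  by (simp add: level_word_def)

lemma hd_level_word: "0 < k \<Longrightarrow> hd (level_word E k \<sigma> y) = level E y"
  by (simp add: level_word_def hd_map)

lemma level_word_Suc: "level_word E (Suc k) \<sigma> y = level E y # level_word E k \<sigma> (\<sigma> y)"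
  by (simp add: level_word_def upt_conv_Cons funpow_swap1 del: upt_Suc flip: map_Suc_upt)

lemma level_word_snoc: "level_word E (Suc k) \<sigma> y = level_word E k \<sigma> y @ [level E ((\<sigma> ^^ k) y)]"
  by (simp add: level_word_def)

text \<open>Advancing by one step drops the first letter, and the letter that enters at the end
  equals it because \<open>k\<close> steps lead back to the same level.\<close>

lemma level_word_step:
  assumes "0 < k" "level E ((\<sigma> ^^ k) y) = level E y"
  shows "level_word E k \<sigma> (\<sigma> y) = rotate1 (level_word E k \<sigma> y)"
proof -
  have "level E y # level_word E k \<sigma> (\<sigma> y) = level_word E k \<sigma> y @ [level E y]"
    using level_word_Suc[of E k \<sigma> y] level_word_snoc[of E k \<sigma> y] assms(2) by simp
  then show ?thesis using assms(1) by (cases "level_word E k \<sigma> y") (auto simp: level_word_def)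
qed

text \<open>Letter \<open>j\<close> of \<open>V y\<close> is the head of its \<open>j\<close>-fold
  rotation, hence the level of \<open>(\<sigma> ^^ j) y\<close>. So heads and the rotation rule
  determine the words, and as \<open>k\<close> rotations are trivial, \<open>\<sigma> ^^ k\<close>
  preserves levels. The lemma serves to recognise permutations with prescribed words.\<close>

lemma level_word_unique:
  assumes "0 < k" "E \<subseteq> {1..n}" "\<sigma> permutes {1..n}"
    and len: "\<And>y. y \<in> {1..n} \<Longrightarrow> length (V y) = k"
    and hd: "\<And>y. y \<in> {1..n} \<Longrightarrow> hd (V y) = level E y"
    and rot: "\<And>y. y \<in> {1..n} \<Longrightarrow> V (\<sigma> y) = rotate1 (V y)"
  shows "\<And>y. y \<in> {1..n} \<Longrightarrow> level_word E k \<sigma> y = V y"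
    and "\<And>y. y \<in> {1..n} \<Longrightarrow> V ((\<sigma> ^^ k) y) = V y"
    and "\<sigma> ^^ k \<in> prefix_stabilizer n E"
proof -
  have pow: "\<sigma> ^^ j permutes {1..n}" for j using assms(3) by (rule permutes_funpow)
  have in_n: "(\<sigma> ^^ j) y \<in> {1..n}" if "y \<in> {1..n}" for j y
    using that pow[of j] by (simp only: permutes_in_image)
  have V: "V ((\<sigma> ^^ j) y) = rotate j (V y)" if "y \<in> {1..n}" for j y
    by (induction j) (use rot in_n[OF that] in auto)
  show word: "level_word E k \<sigma> y = V y" if y: "y \<in> {1..n}" for y
  proof (rule nth_equalityI)
    fix j assume "j < length (level_word E k \<sigma> y)"
    then have j: "j < k" by simp
    have "level E ((\<sigma> ^^ j) y) = hd (rotate j (V y))" using hd[OF in_n[OF y]] V[OF y] by simp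
    also have "\<dots> = V y ! j" using j len[OF y] by (subst hd_rotate_conv_nth) auto
    finally show "level_word E k \<sigma> y ! j = V y ! j" using j by (simp add: nth_level_word)
  qed (use len y in auto)
  show Vk: "V ((\<sigma> ^^ k) y) = V y" if "y \<in> {1..n}" for y using V[OF that] len[OF that] by simp
  show "\<sigma> ^^ k \<in> prefix_stabilizer n E"
    unfolding prefix_stabilizer_iff_level[OF assms(2) pow]
  proof
    fix y assume y: "y \<in> {1..n}"
    then have "level E ((\<sigma> ^^ k) y) = hd (V ((\<sigma> ^^ k) y))" using hd[OF in_n[OF y]] by simp
    then show "level E ((\<sigma> ^^ k) y) = level E y" using Vk[OF y] hd[OF y] by simp
  qed
qed

lemma append_mono_lexorder:
  fixes xs ys zs :: "'a::linorder list"
  assumes "length xs = length ys" "xs \<le> ys"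
  shows "xs @ zs \<le> ys @ zs"
  using assms
proof (induction xs ys rule: list_induct2)
  case (Cons x xs y ys)
  from Cons.prems have "x < y \<or> x = y \<and> xs \<le> ys" by (simp only: Cons_le_Cons)
  then show ?case using Cons.IH by (auto simp only: append_Cons Cons_le_Cons)
qed (rule order_refl)

text \<open>When the first letters agree, the tails decide the comparison, and rotation appends the
  same letter to both tails.\<close>

lemma rotate1_mono_lexorder:
  fixes xs ys :: "'a::linorder list"
  assumes "length xs = length ys" "hd xs = hd ys" "xs \<le> ys"
  shows "rotate1 xs \<le> rotate1 ys"
proof (cases "xs = []")
  case False
  then obtain x xs' ys' where xs: "xs = x # xs'" "ys = x # ys'"
    using assms(1,2) by (metis length_0_conv list.exhaust_sel)
  then have "xs' @ [x] \<le> ys' @ [x]"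
    using assms(1,3) by (intro append_mono_lexorder) (auto simp only: Cons_le_Cons list.size)
  then show ?thesis unfolding xs by (simp only: rotate1.simps)
qed (use assms in auto)

lemma hd_mono_lexorder:
  fixes xs ys :: "'a::linorder list"
  assumes "length xs = length ys" "xs \<le> ys" "xs \<noteq> []"
  shows "hd xs \<le> hd ys"
proof -
  obtain x xs' y ys' where xs: "xs = x # xs'" "ys = y # ys'"
    using assms(1,3) by (metis length_0_conv list.exhaust)
  then show ?thesis using assms(2) by (auto simp only: Cons_le_Cons list.sel)
qed

section \<open>Roots of the identity with descents in \<open>E\<close>, and their words\<close>

definition descent_roots :: "nat \<Rightarrow> nat \<Rightarrow> nat set \<Rightarrow> (nat \<Rightarrow> nat) set" where
  "descent_roots n k E = {\<tau> \<in> identity_roots n k. descent_set n \<tau> \<subseteq> E}"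

lemma finite_identity_roots: "finite (identity_roots n k)"
  by (rule finite_subset[OF _ finite_permutations[of "{1..n}"]])
    (auto simp: identity_roots_def symm_perms_def)

lemma finite_descent_roots: "finite (descent_roots n k E)"
  using finite_identity_roots by (simp add: descent_roots_def)

text \<open>Equal levels mean that no element of \<open>E\<close> lies in \<open>{y..<z}\<close>, so
  every single step from \<open>y\<close> to \<open>z\<close> is an ascent of
  \<open>\<tau>\<close>.\<close>

lemma less_on_level:
  assumes "finite E" "\<tau> permutes {1..n}" "descent_set n \<tau> \<subseteq> E"
    and "1 \<le> y" "y < z" "z \<le> n" "level E y = level E z"
  shows "\<tau> y < \<tau> z"
  using assms(5-7)
proof (induction z)
  case (Suc z)
  have "level E y \<le> level E z" "level E z \<le> level E (Suc z)"
    using Suc.prems level_mono[OF assms(1), of y z] level_mono[OF assms(1), of z "Suc z"] by simp_all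
  then have lev: "level E z = level E (Suc z)" "level E y = level E z" using Suc.prems by auto
  have "z \<notin> E"
    using level_le_iff[OF assms(1), of z "Suc z"] lev by auto
  then have "\<not> \<tau> z > \<tau> (z + 1)"
    using assms(3,4) Suc.prems by (auto simp: descent_set_def subset_iff)
  moreover have "\<tau> z \<noteq> \<tau> (Suc z)"
    using permutes_inj[OF assms(2)] by (metis injD n_not_Suc_n)
  ultimately have "\<tau> z < \<tau> (Suc z)" by simp
  then show ?case
    using Suc.IH Suc.prems lev by (cases "y = z") auto
qed simp

text \<open>Either the first letters differ and decide, or \<open>\<tau>\<close> keeps
  \<open>y\<close> and \<open>z\<close> in order and the comparison passes to the words of
  \<open>\<tau> y\<close> and \<open>\<tau> z\<close>, which are one letter shorter.\<close>

lemma level_word_mono_on: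
  assumes "finite E" "\<tau> permutes {1..n}" "descent_set n \<tau> \<subseteq> E"
  shows "mono_on {1..n} (level_word E k \<tau>)"
proof -
  have "level_word E k \<tau> y \<le> level_word E k \<tau> z" if "y \<in> {1..n}" "z \<in> {1..n}" "y < z" for y z
    using that
  proof (induction k arbitrary: y z)
    case 0
    then show ?case by (simp add: level_word_def)
  next
    case (Suc k)
    show ?case
    proof (cases "level E y = level E z")
      case True
      then have "\<tau> y < \<tau> z" using Suc.prems less_on_level[OF assms] by simp
      moreover have "\<tau> y \<in> {1..n}" "\<tau> z \<in> {1..n}"
        using Suc.prems assms(2) by (simp_all only: permutes_in_image)
      ultimately show ?thesis using Suc.IH True by (simp add: level_word_Suc)
    next
      case False
      then have "level E y < level E z"
        using level_mono[OF assms(1), of y z] Suc.prems by simp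
      then show ?thesis by (simp add: level_word_Suc)
    qed
  qed
  then show ?thesis by (auto simp: mono_on_def order.order_iff_strict)
qed

text \<open>The existence half of the Gessel-Reutenauer correspondence. The root sends
  \<open>y\<close> to the rank of the rotated word of \<open>y\<close> among all rotated words, ties
  being broken by position.\<close>

lemma ex_descent_root:
  assumes "0 < k" "E \<subseteq> {1..n}" "\<sigma> permutes {1..n}" "\<sigma> ^^ k \<in> prefix_stabilizer n E"
    and mono: "mono_on {1..n} (level_word E k \<sigma>)"
  shows "\<exists>\<tau>\<in>descent_roots n k E. \<forall>y\<in>{1..n}. level_word E k \<tau> y = level_word E k \<sigma> y"
proof -
  define V where "V = level_word E k \<sigma>"
  obtain h where h: "h permutes {1..n}" and sorted: "\<And>i j. 1 \<le> i \<Longrightarrow> i < j \<Longrightarrow> j \<le> n \<Longrightarrow>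
      rotate1 (V (h i)) < rotate1 (V (h j)) \<or> rotate1 (V (h i)) = rotate1 (V (h j)) \<and> h i < h j"
    using stable_sort_permutation[of n "\<lambda>y. rotate1 (V y)"] by blast
  have step: "rotate1 (V y) = V (\<sigma> y)" if "y \<in> {1..n}" for y
    unfolding V_def
    by (rule level_word_step[symmetric])
      (use assms that prefix_stabilizer_iff_level[OF assms(2) permutes_funpow[OF assms(3)]] in auto)
  \<comment> \<open>Rotating the word of a point gives the word of its image under
    \<open>\<sigma>\<close>, so rotation only rearranges the family of words. The sorted rotated
    words therefore coincide with the already sorted words \<open>V\<close>.\<close>
  have Vh: "rotate1 (V (h i)) = V i" if "i \<in> {1..n}" for i
  proof (rule rearranged_mono_on_eq[where g = "\<sigma> \<circ> h" and n = n])
    show "\<sigma> \<circ> h permutes {1..n}" using h assms(3) by (simp add: permutes_compose)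
    show "rotate1 (V (h i)) = V ((\<sigma> \<circ> h) i)" if "i \<in> {1..n}" for i
      using that h step[of "h i"] by (simp only: permutes_in_image o_apply)
    show "mono_on {1..n} (\<lambda>i. rotate1 (V (h i)))"
    proof (rule mono_onI)
      fix i j assume "i \<in> {1..n}" "j \<in> {1..n}" "i \<le> j"
      then show "rotate1 (V (h i)) \<le> rotate1 (V (h j))"
        using sorted[of i j] by (cases "i = j") auto
    qed
  qed (use that mono in \<open>auto simp: V_def\<close>)
  \<comment> \<open>The stable sort breaks ties by position, so \<open>\<tau>\<close> preserves the order among positions with equal
    words; this forces both the descent condition and \<open>\<tau>\<^sup>k = 1\<close>.\<close>
  define \<tau> where "\<tau> = inv h"
  have \<tau>: "\<tau> permutes {1..n}" unfolding \<tau>_def using h by (rule permutes_inv)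
  have in_n: "\<tau> y \<in> {1..n}" if "y \<in> {1..n}" for y
    using that \<tau> by (simp only: permutes_in_image)
  have h\<tau>: "h (\<tau> y) = y" for y unfolding \<tau>_def using h by (simp add: permutes_inverses)
  have V\<tau>: "V (\<tau> y) = rotate1 (V y)" if "y \<in> {1..n}" for y
    using Vh[OF in_n[OF that]] h\<tau> by simp
  have less: "\<tau> y < \<tau> z" if "y \<in> {1..n}" "z \<in> {1..n}" "y < z" "rotate1 (V y) \<le> rotate1 (V z)" for y z
  proof (rule ccontr)
    assume "\<not> \<tau> y < \<tau> z"
    moreover have "\<tau> y \<noteq> \<tau> z" using that permutes_inj[OF \<tau>] by (metis injD less_irrefl)
    ultimately have "\<tau> z < \<tau> y" by simp
    from sorted[OF _ this] in_n[OF that(1)] in_n[OF that(2)] that(3,4) show False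
      by (auto simp: h\<tau>)
  qed
  have hdV: "hd (V y) = level E y" and lenV: "length (V y) = k" for y
    using assms(1) by (auto simp: V_def hd_level_word)
  note unique = level_word_unique[OF assms(1,2) \<tau> lenV hdV V\<tau>]
  have "\<tau> ^^ k = id"
  proof (rule permutes_strict_mono_on_fibres_eq_id)
    show "\<tau> ^^ k permutes {1..n}" using \<tau> by (rule permutes_funpow)
    show "V ((\<tau> ^^ k) y) = V y" if "y \<in> {1..n}" for y using unique(2) that by simp
    show "(\<tau> ^^ k) y < (\<tau> ^^ k) z"
      if "y \<in> {1..n}" "z \<in> {1..n}" "y < z" "V y = V z" for y z
    proof -
      have "(\<tau> ^^ j) y \<in> {1..n} \<and> (\<tau> ^^ j) z \<in> {1..n} \<and> (\<tau> ^^ j) y < (\<tau> ^^ j) z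
          \<and> V ((\<tau> ^^ j) y) = V ((\<tau> ^^ j) z)" for j
        by (induction j) (use that less in_n V\<tau> in auto)
      then show ?thesis by blast
    qed
  qed
  moreover have "descent_set n \<tau> \<subseteq> E"
  proof (rule subsetI, rule ccontr)
    fix y assume y: "y \<in> descent_set n \<tau>" "y \<notin> E"
    then have yn: "y \<in> {1..n}" "Suc y \<in> {1..n}" and gt: "\<tau> (Suc y) < \<tau> y"
      by (auto simp: descent_set_def)
    \<comment> \<open>Since \<open>y\<close> is not in \<open>E\<close>, the words at
      \<open>y\<close> and \<open>Suc y\<close> start with the same letter, and rotation preserves
      their order.\<close>
    have "rotate1 (V y) \<le> rotate1 (V (Suc y))"
      by (rule rotate1_mono_lexorder)
        (use y yn mono level_Suc in \<open>auto simp: lenV hdV mono_on_def simp flip: V_def\<close>)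
    with less[OF yn] gt show False by simp
  qed
  ultimately have "\<tau> \<in> descent_roots n k E"
    using \<tau> by (simp add: descent_roots_def identity_roots_def symm_perms_def)
  moreover have "level_word E k \<tau> y = V y" if "y \<in> {1..n}" for y using unique(1) that by simp
  ultimately show ?thesis unfolding V_def by blast
qed

text \<open>Words of roots with descents in \<open>E\<close> are sorted, so words that agree up to a
  rearrangement agree exactly. Then \<open>inv \<tau>' \<circ> \<tau>\<close> preserves words,
  because rotation is injective, and it preserves the order of positions with equal words, so it is
  the identity.\<close>

lemma descent_root_unique:
  assumes "0 < k" "E \<subseteq> {1..n}" "\<tau> \<in> descent_roots n k E" "\<tau>' \<in> descent_roots n k E"
    and g: "g permutes {1..n}" "\<And>y. y \<in> {1..n} \<Longrightarrow> level_word E k \<tau> y = level_word E k \<tau>' (g y)"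
  shows "\<tau> = \<tau>'"
proof -
  have fin: "finite E" using assms(2) finite_subset by blast
  have \<tau>: "\<tau> permutes {1..n}" "\<tau> ^^ k = id" "descent_set n \<tau> \<subseteq> E"
    and \<tau>': "\<tau>' permutes {1..n}" "\<tau>' ^^ k = id" "descent_set n \<tau>' \<subseteq> E"
    using assms(3,4) by (auto simp: descent_roots_def identity_roots_def symm_perms_def)
  define V where "V = level_word E k \<tau>"
  have V': "level_word E k \<tau>' y = V y" if "y \<in> {1..n}" for y
    unfolding V_def
    by (rule rearranged_mono_on_eq[OF g level_word_mono_on[OF fin \<tau>(1,3)]
      level_word_mono_on[OF fin \<tau>'(1,3)] that, symmetric])
  define \<psi> where "\<psi> = inv \<tau>' \<circ> \<tau>"
  have \<psi>: "\<psi> permutes {1..n}" unfolding \<psi>_def using \<tau>(1) \<tau>'(1) by (simp add: permutes_compose permutes_inv)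
  have \<tau>'\<psi>: "\<tau>' (\<psi> y) = \<tau> y" for y unfolding \<psi>_def using \<tau>'(1) by (simp add: permutes_inverses)
  have in_n: "\<psi> y \<in> {1..n}" "\<tau> y \<in> {1..n}" if "y \<in> {1..n}" for y
    using that \<psi> \<tau>(1) by (simp_all only: permutes_in_image)
  have V\<psi>: "V (\<psi> y) = V y" if y: "y \<in> {1..n}" for y
  proof -
    have "rotate1 (V (\<psi> y)) = V (\<tau>' (\<psi> y))"
      using level_word_step[of k E \<tau>' "\<psi> y"] assms(1) \<tau>'(2) V' in_n[OF y] \<tau>'\<psi>
      by simp
    also have "\<dots> = rotate1 (V y)"
      unfolding \<tau>'\<psi> V_def by (rule level_word_step) (use assms(1) \<tau>(2) in auto)
    finally show ?thesis by (rule injD[OF inj_rotate1])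
  qed
  have hdV: "hd (V y) = level E y" for y
    using assms(1) by (auto simp: V_def hd_level_word)
  have "\<psi> = id"
  proof (rule permutes_strict_mono_on_fibres_eq_id[where W = V, OF \<psi> V\<psi>])
    fix y z assume yz: "y \<in> {1..n}" "z \<in> {1..n}" "y < z" "V y = V z"
    then have "level E y = level E z" using hdV by metis
    then have less: "\<tau> y < \<tau> z" using less_on_level[OF fin \<tau>(1,3)] yz by simp
    have "level E (\<psi> y) = level E (\<psi> z)" using V\<psi> yz hdV by metis
    then have "\<tau>' (\<psi> z) < \<tau>' (\<psi> y)" if "\<psi> z < \<psi> y"
      using less_on_level[OF fin \<tau>'(1,3)] that in_n[OF yz(1)] in_n[OF yz(2)] by simp
    with less show "\<psi> y < \<psi> z" unfolding \<tau>'\<psi> by (metis \<tau>'\<psi> less_asym less_irrefl linorder_neqE_nat)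
  qed
  then show ?thesis using \<tau>'\<psi> by (auto simp: fun_eq_iff)
qed

section \<open>Counting \<open>k\<close>-th roots of the elements of a Young subgroup\<close>

lemma card_eq_sum_card_fibres:
  assumes "finite A"
  shows "card A = (\<Sum>v\<in>f ` A. card {a \<in> A. f a = v})"
  using sum.image_gen[OF assms, of "\<lambda>_. 1 :: nat" f] by (simp only: card_eq_sum)

lemma card_eq_if_fibres_eq:
  assumes "finite A" "finite B" "p ` A = q ` B"
    and "\<And>v. v \<in> q ` B \<Longrightarrow> card {a \<in> A. p a = v} = card {b \<in> B. q b = v}"
  shows "card A = card B"
proof -
  have "card A = (\<Sum>v\<in>q ` B. card {a \<in> A. p a = v})"
    unfolding assms(3)[symmetric] by (rule card_eq_sum_card_fibres[OF assms(1)])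
  also have "\<dots> = (\<Sum>v\<in>q ` B. card {b \<in> B. q b = v})"
    by (rule sum.cong[OF refl assms(4)])
  also have "\<dots> = card B"
    by (rule card_eq_sum_card_fibres[OF assms(2), symmetric])
  finally show ?thesis .
qed

text \<open>Both sides are counted over families of words indexed by \<open>{1..n}\<close>. A
  permutation \<open>\<sigma>\<close> contributes its own words (\<open>q\<close>), a pair
  \<open>(\<tau>, g)\<close> the words of \<open>\<tau>\<close> rearranged by \<open>g\<close>
  (\<open>p\<close>). The two maps have the same image and fibres of equal size.\<close>

lemma card_powers_in_prefix_stabilizer:
  assumes "0 < k" "E \<subseteq> {1..n}"
  shows "card {\<sigma>. \<sigma> permutes {1..n} \<and> \<sigma> ^^ k \<in> prefix_stabilizer n E} =
    card (prefix_stabilizer n E) * card (descent_roots n k E)"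
proof -
  have fin: "finite E" using assms(2) finite_subset by blast
  define A where "A = descent_roots n k E \<times> prefix_stabilizer n E"
  define B where "B = {\<sigma>. \<sigma> permutes {1..n} \<and> \<sigma> ^^ k \<in> prefix_stabilizer n E}"
  define p where "p = (\<lambda>(\<tau>, g). restrict (\<lambda>y. level_word E k \<tau> (g y)) {1..n})"
  define q where "q \<sigma> = restrict (level_word E k \<sigma>) {1..n}" for \<sigma>
  define St where "St v = {s. s permutes {1..n} \<and> (\<forall>y\<in>{1..n}. v (s y) = v y)}"
    for v :: "nat \<Rightarrow> nat list"
  note stab_iff = prefix_stabilizer_iff_level[OF assms(2)]
  have stabD: "g permutes {1..n}" if "g \<in> prefix_stabilizer n E" for g
    using that by (simp add: prefix_stabilizer_def)
  have in_n: "g y \<in> {1..n}" if "g permutes {1..n}" "y \<in> {1..n}" for g y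
    using that by (simp only: permutes_in_image)
  have p_eq: "p a = v \<longleftrightarrow> (\<forall>y\<in>{1..n}. level_word E k (fst a) (snd a y) = v y)"
    if "v \<in> extensional {1..n}" for a v
    unfolding p_def using that by (auto simp: fun_eq_iff extensional_def restrict_def split: prod.splits)
  have q_eq: "q b = v \<longleftrightarrow> (\<forall>y\<in>{1..n}. level_word E k b y = v y)"
    if "v \<in> extensional {1..n}" for b v
    unfolding q_def using that by (auto simp: fun_eq_iff extensional_def restrict_def)
  have finA: "finite A" unfolding A_def
    using finite_descent_roots finite_prefix_stabilizer by simp
  have finB: "finite B" unfolding B_def
    by (rule finite_subset[OF _ finite_permutations[of "{1..n}"]]) auto
  \<comment> \<open>The conjugate of \<open>\<tau>\<close> by \<open>g\<close> realises the
    rearranged words, since \<open>g\<close> preserves levels; its \<open>k\<close>-th power is the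
    identity.\<close>
  have sub1: "p a \<in> q ` B" if "a \<in> A" for a
  proof -
    obtain \<tau> g where a: "a = (\<tau>, g)" by force
    have \<tau>: "\<tau> permutes {1..n}" "\<tau> ^^ k = id" and g: "g \<in> prefix_stabilizer n E" "g permutes {1..n}"
      using that stabD unfolding a A_def
      by (auto simp: descent_roots_def identity_roots_def symm_perms_def)
    have bij: "bij g" using g(2) by (rule permutes_bij)
    define \<sigma> where "\<sigma> = inv g \<circ> \<tau> \<circ> g"
    have \<sigma>: "\<sigma> permutes {1..n}" unfolding \<sigma>_def using g \<tau> by (simp add: permutes_compose permutes_inv)
    have pow: "\<sigma> ^^ j = inv g \<circ> \<tau> ^^ j \<circ> g" for j unfolding \<sigma>_def using bij by (rule conjugate_funpow)
    have "\<sigma> ^^ k = id" unfolding pow \<tau>(2) using bij by (simp add: bij_is_inj)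
    then have "\<sigma> \<in> B" unfolding B_def prefix_stabilizer_def using \<sigma> by (simp add: permutes_id)
    moreover have "level E ((\<sigma> ^^ j) y) = level E ((\<tau> ^^ j) (g y))" if y: "y \<in> {1..n}" for j y
    proof -
      have "g ((\<sigma> ^^ j) y) = (\<tau> ^^ j) (g y)" unfolding pow using g(2) by (simp add: permutes_inverses)
      moreover have "level E (g ((\<sigma> ^^ j) y)) = level E ((\<sigma> ^^ j) y)"
        using g stab_iff[OF g(2)] in_n[OF permutes_funpow[OF \<sigma>] y] by blast
      ultimately show ?thesis by simp
    qed
    then have "q \<sigma> = p a"
      unfolding a q_def p_def by (auto simp: fun_eq_iff restrict_def level_word_def)
    ultimately show ?thesis by (metis image_eqI)
  qed
  \<comment> \<open>Conjugating \<open>\<sigma>\<close> by a permutation \<open>h\<close> that sorts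
    its words makes the words increase with position, which is the situation of
    \<open>ex_descent_root\<close>; \<open>inv h\<close> then restores the original
    arrangement.\<close>
  have sub2: "q \<sigma> \<in> p ` A" if "\<sigma> \<in> B" for \<sigma>
  proof -
    have \<sigma>: "\<sigma> permutes {1..n}" "\<sigma> ^^ k \<in> prefix_stabilizer n E" using that by (auto simp: B_def)
    obtain h where h: "h permutes {1..n}" and sorted: "\<And>i j. 1 \<le> i \<Longrightarrow> i < j \<Longrightarrow> j \<le> n \<Longrightarrow>
        level_word E k \<sigma> (h i) < level_word E k \<sigma> (h j) \<or>
        level_word E k \<sigma> (h i) = level_word E k \<sigma> (h j) \<and> h i < h j"
      using stable_sort_permutation[of n "level_word E k \<sigma>"] by blast
    have mono: "mono_on {1..n} (\<lambda>y. level_word E k \<sigma> (h y))"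
    proof (rule mono_onI)
      fix i j assume "i \<in> {1..n}" "j \<in> {1..n}" "i \<le> j"
      then show "level_word E k \<sigma> (h i) \<le> level_word E k \<sigma> (h j)"
        using sorted[of i j] by (cases "i = j") auto
    qed
    have bij: "bij h" using h by (rule permutes_bij)
    \<comment> \<open>The heads of the sorted words are the levels in increasing order, so sorting
      moves no point to another level.\<close>
    have hlev: "level E (h y) = level E y" if "y \<in> {1..n}" for y
    proof (rule rearranged_mono_on_eq[where V = "\<lambda>y. level E (h y)", OF h refl _ _ that])
      show "mono_on {1..n} (\<lambda>y. level E (h y))"
      proof (rule mono_onI)
        fix y z assume "y \<in> {1..n}" "z \<in> {1..n}" "y \<le> z"
        then have "level_word E k \<sigma> (h y) \<le> level_word E k \<sigma> (h z)"
          using mono by (auto simp: mono_on_def)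
        then show "level E (h y) \<le> level E (h z)"
          using hd_mono_lexorder[of "level_word E k \<sigma> (h y)" "level_word E k \<sigma> (h z)"] assms(1)
          by (simp add: hd_level_word flip: length_0_conv)
      qed
      show "mono_on {1..n} (level E)" using level_mono[OF fin] by (auto simp: mono_on_def)
    qed
    have hst': "inv h \<in> prefix_stabilizer n E"
      unfolding stab_iff[OF permutes_inv[OF h]]
    proof
      fix y assume "y \<in> {1..n}"
      from hlev[OF in_n[OF permutes_inv[OF h] this]] show "level E (inv h y) = level E y"
        using h by (simp add: permutes_inverses)
    qed
    define \<sigma>' where "\<sigma>' = inv h \<circ> \<sigma> \<circ> h"
    have \<sigma>': "\<sigma>' permutes {1..n}" unfolding \<sigma>'_def using h \<sigma> by (simp add: permutes_compose permutes_inv)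
    have pow: "\<sigma>' ^^ j = inv h \<circ> \<sigma> ^^ j \<circ> h" for j unfolding \<sigma>'_def using bij by (rule conjugate_funpow)
    have lev: "level E ((\<sigma>' ^^ j) y) = level E ((\<sigma> ^^ j) (h y))" if y: "y \<in> {1..n}" for j y
    proof -
      have "h ((\<sigma>' ^^ j) y) = (\<sigma> ^^ j) (h y)" unfolding pow using h by (simp add: permutes_inverses)
      moreover have "level E (h ((\<sigma>' ^^ j) y)) = level E ((\<sigma>' ^^ j) y)"
        using hlev in_n[OF permutes_funpow[OF \<sigma>'] y] by blast
      ultimately show ?thesis by simp
    qed
    have word: "level_word E k \<sigma>' y = level_word E k \<sigma> (h y)" if "y \<in> {1..n}" for y
      using lev[OF that] by (simp add: level_word_def)
    have "\<sigma>' ^^ k \<in> prefix_stabilizer n E"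
      unfolding stab_iff[OF permutes_funpow[OF \<sigma>']]
    proof
      fix y assume y: "y \<in> {1..n}"
      have "level E ((\<sigma> ^^ k) (h y)) = level E (h y)"
        using \<sigma>(2) in_n[OF h y] unfolding stab_iff[OF permutes_funpow[OF \<sigma>(1)]] by blast
      then show "level E ((\<sigma>' ^^ k) y) = level E y" using lev[OF y] hlev[OF y] by simp
    qed
    moreover have "mono_on {1..n} (level_word E k \<sigma>')"
      using mono word by (auto simp: mono_on_def)
    ultimately obtain \<tau> where \<tau>: "\<tau> \<in> descent_roots n k E"
      "\<And>y. y \<in> {1..n} \<Longrightarrow> level_word E k \<tau> y = level_word E k \<sigma>' y"
      using ex_descent_root[OF assms \<sigma>'] by blast
    have "level_word E k \<tau> (inv h y) = level_word E k \<sigma> y" if y: "y \<in> {1..n}" for y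
      using \<tau>(2)[OF in_n[OF permutes_inv[OF h] y]] word[OF in_n[OF permutes_inv[OF h] y]]
      by (simp add: permutes_inverses[OF h])
    then have "p (\<tau>, inv h) = q \<sigma>" by (auto simp: p_def q_def fun_eq_iff restrict_def)
    moreover have "(\<tau>, inv h) \<in> A" using \<tau>(1) hst' by (simp add: A_def)
    ultimately show ?thesis by (metis image_eqI)
  qed
  have img: "p ` A = q ` B" using sub1 sub2 by blast
  \<comment> \<open>Both fibres are torsors under the stabilizer \<open>St v\<close> of the family of words \<open>v\<close>.\<close>
  have "card {a \<in> A. p a = v} = card {b \<in> B. q b = v}" if v_in: "v \<in> q ` B" for v
  proof -
    obtain \<sigma>0 where \<sigma>0: "\<sigma>0 \<in> B" "q \<sigma>0 = v" using v_in by blast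
    then have \<sigma>0p: "\<sigma>0 permutes {1..n}" by (simp add: B_def)
    have ext: "v \<in> extensional {1..n}" using \<sigma>0(2) by (auto simp: q_def)
    have v: "v y = level_word E k \<sigma>0 y" if "y \<in> {1..n}" for y
      using \<sigma>0(2) that by (auto simp: q_def)
    have hdv: "hd (v y) = level E y" and lenv: "length (v y) = k" if "y \<in> {1..n}" for y
      using v[OF that] assms(1) by (auto simp: hd_level_word)
    have rotate: "v (\<sigma> y) = rotate1 (v y)" if "\<sigma> \<in> B" "q \<sigma> = v" "y \<in> {1..n}" for \<sigma> y
    proof -
      have \<sigma>: "\<sigma> permutes {1..n}" "\<sigma> ^^ k \<in> prefix_stabilizer n E" using that(1) by (auto simp: B_def)
      have "level E ((\<sigma> ^^ k) y) = level E y"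
        using \<sigma>(2) stab_iff[OF permutes_funpow[OF \<sigma>(1)]] that(3) by blast
      then have "level_word E k \<sigma> (\<sigma> y) = rotate1 (level_word E k \<sigma> y)"
        by (rule level_word_step[OF assms(1)])
      moreover have "level_word E k \<sigma> z = v z" if "z \<in> {1..n}" for z
        using \<open>q \<sigma> = v\<close> that unfolding q_eq[OF ext] by blast
      ultimately show ?thesis using that(3) in_n[OF \<sigma>(1) that(3)] by simp
    qed
    \<comment> \<open>The permutations in this fibre are those that rotate the words of
      \<open>v\<close>, and two of them differ by a factor that fixes every word.\<close>
    have "bij_betw (\<lambda>s. s \<circ> \<sigma>0) (St v) {b \<in> B. q b = v}"
    proof (rule bij_betw_byWitness[where f' = "\<lambda>\<sigma>. \<sigma> \<circ> inv \<sigma>0"])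
      show "\<forall>s\<in>St v. s \<circ> \<sigma>0 \<circ> inv \<sigma>0 = s" "\<forall>\<sigma>\<in>{b \<in> B. q b = v}. \<sigma> \<circ> inv \<sigma>0 \<circ> \<sigma>0 = \<sigma>"
        using \<sigma>0p by (auto simp: fun_eq_iff permutes_inverses)
      show "(\<lambda>s. s \<circ> \<sigma>0) ` St v \<subseteq> {b \<in> B. q b = v}"
      proof (rule image_subsetI)
        fix s assume "s \<in> St v"
        then have s: "s permutes {1..n}" "\<And>y. y \<in> {1..n} \<Longrightarrow> v (s y) = v y" by (auto simp: St_def)
        have perm: "s \<circ> \<sigma>0 permutes {1..n}" using s(1) \<sigma>0p by (simp add: permutes_compose)
        have "v ((s \<circ> \<sigma>0) y) = rotate1 (v y)" if "y \<in> {1..n}" for y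
          using s(2)[OF in_n[OF \<sigma>0p that]] rotate[OF \<sigma>0 that] by simp
        note unique = level_word_unique[where V = v, OF assms perm lenv hdv this]
        have "(s \<circ> \<sigma>0) ^^ k \<in> prefix_stabilizer n E" by (rule unique(3))
        moreover have "q (s \<circ> \<sigma>0) = v" unfolding q_eq[OF ext] using unique(1) by blast
        ultimately show "s \<circ> \<sigma>0 \<in> {b \<in> B. q b = v}" using perm by (simp add: B_def)
      qed
      show "(\<lambda>\<sigma>. \<sigma> \<circ> inv \<sigma>0) ` {b \<in> B. q b = v} \<subseteq> St v"
      proof (rule image_subsetI)
        fix \<sigma> assume "\<sigma> \<in> {b \<in> B. q b = v}"
        then have \<sigma>: "\<sigma> \<in> B" "q \<sigma> = v" "\<sigma> permutes {1..n}" by (auto simp: B_def)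
        have "v ((\<sigma> \<circ> inv \<sigma>0) y) = v y" if "y \<in> {1..n}" for y
          using rotate[OF \<sigma>(1,2) in_n[OF permutes_inv[OF \<sigma>0p] that]]
            rotate[OF \<sigma>0 in_n[OF permutes_inv[OF \<sigma>0p] that]] \<sigma>0p
          by (simp add: permutes_inverses)
        then show "\<sigma> \<circ> inv \<sigma>0 \<in> St v"
          using \<sigma>(3) \<sigma>0p by (simp add: St_def permutes_compose permutes_inv)
      qed
    qed
    then have card_q: "card (St v) = card {b \<in> B. q b = v}" by (rule bij_betw_same_card)
    have "v \<in> p ` A" unfolding img by (rule v_in)
    then obtain \<tau>0 g0 where a0: "(\<tau>0, g0) \<in> A" "p (\<tau>0, g0) = v" by (metis imageE prod.exhaust)
    then have \<tau>0: "\<tau>0 \<in> descent_roots n k E" and g0: "g0 \<in> prefix_stabilizer n E" by (auto simp: A_def)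
    have g0p: "g0 permutes {1..n}" using g0 by (rule stabD)
    have v0: "level_word E k \<tau>0 (g0 y) = v y" if "y \<in> {1..n}" for y
      using a0(2) that p_eq[OF ext] by auto
    \<comment> \<open>By \<open>descent_root_unique\<close> the family \<open>v\<close> determines
      the root, so only the arrangement varies within the fibre.\<close>
    have "bij_betw (\<lambda>s. (\<tau>0, g0 \<circ> s)) (St v) {a \<in> A. p a = v}"
    proof (rule bij_betw_byWitness[where f' = "\<lambda>(\<tau>, g). inv g0 \<circ> g"])
      have fibre: "\<tau> = \<tau>0 \<and> inv g0 \<circ> g \<in> St v" if "(\<tau>, g) \<in> A" "p (\<tau>, g) = v" for \<tau> g
      proof -
        have \<tau>: "\<tau> \<in> descent_roots n k E" and g: "g \<in> prefix_stabilizer n E" using that by (auto simp: A_def)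
        have gp: "g permutes {1..n}" using g by (rule stabD)
        have vg: "level_word E k \<tau> (g y) = v y" if "y \<in> {1..n}" for y
          using \<open>p (\<tau>, g) = v\<close> that p_eq[OF ext] by auto
        have "\<tau> = \<tau>0"
        proof (rule descent_root_unique[where g = "g0 \<circ> inv g", OF assms \<tau> \<tau>0])
          show "g0 \<circ> inv g permutes {1..n}" using gp g0p by (simp add: permutes_compose permutes_inv)
          show "level_word E k \<tau> y = level_word E k \<tau>0 ((g0 \<circ> inv g) y)" if "y \<in> {1..n}" for y
            using vg[OF in_n[OF permutes_inv[OF gp] that]] v0[OF in_n[OF permutes_inv[OF gp] that]] gp
            by (simp add: permutes_inverses)
        qed
        moreover have "v (inv g0 (g y)) = v y" if y: "y \<in> {1..n}" for y
          using v0[OF in_n[OF permutes_inv[OF g0p] in_n[OF gp y]]] vg[OF y] g0p \<open>\<tau> = \<tau>0\<close>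
          by (simp add: permutes_inverses)
        ultimately show ?thesis using gp g0p by (simp add: St_def permutes_compose permutes_inv)
      qed
      show "\<forall>s\<in>St v. (case (\<tau>0, g0 \<circ> s) of (\<tau>, g) \<Rightarrow> inv g0 \<circ> g) = s"
        using g0p by (auto simp: fun_eq_iff permutes_inverses)
      show "\<forall>a\<in>{a \<in> A. p a = v}. (\<tau>0, g0 \<circ> (case a of (\<tau>, g) \<Rightarrow> inv g0 \<circ> g)) = a"
        using fibre g0p by (auto simp: fun_eq_iff permutes_inverses)
      show "(\<lambda>a. case a of (\<tau>, g) \<Rightarrow> inv g0 \<circ> g) ` {a \<in> A. p a = v} \<subseteq> St v"
        using fibre by auto
      show "(\<lambda>s. (\<tau>0, g0 \<circ> s)) ` St v \<subseteq> {a \<in> A. p a = v}"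
      proof (rule image_subsetI)
        fix s assume "s \<in> St v"
        then have s: "s permutes {1..n}" "\<And>y. y \<in> {1..n} \<Longrightarrow> v (s y) = v y" by (auto simp: St_def)
        have perm: "g0 \<circ> s permutes {1..n}" using s(1) g0p by (simp add: permutes_compose)
        have "level E (g0 (s y)) = level E y" if y: "y \<in> {1..n}" for y
        proof -
          have "level E (g0 (s y)) = level E (s y)"
            using g0 stab_iff[OF g0p] in_n[OF s(1) y] by blast
          also have "\<dots> = level E y" using hdv[OF in_n[OF s(1) y]] s(2)[OF y] hdv[OF y] by simp
          finally show ?thesis .
        qed
        then have "g0 \<circ> s \<in> prefix_stabilizer n E" using stab_iff[OF perm] by simp
        moreover have "p (\<tau>0, g0 \<circ> s) = v"
          unfolding p_eq[OF ext] using v0 in_n[OF s(1)] s(2) by simp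
        ultimately show "(\<tau>0, g0 \<circ> s) \<in> {a \<in> A. p a = v}" using \<tau>0 by (simp add: A_def)
      qed
    qed
    then show ?thesis using card_q by (simp add: bij_betw_same_card)
  qed
  from card_eq_if_fibres_eq[where p = p and q = q, OF finA finB img this] show ?thesis
    by (simp add: A_def B_def card_cartesian_product mult.commute)
qed

section \<open>Chains of subsets containing prescribed prefixes\<close>

text \<open>Flags of nonempty subsets that refine the chain of block prefixes. A flag is encoded as
  the set of its members, so that refining or coarsening it by one step is insertion or deletion of
  an element.\<close>

definition prefix_chains :: "nat \<Rightarrow> nat set \<Rightarrow> nat set set set" where
  "prefix_chains n S = {\<C>. \<C> \<subseteq> Pow {1..n} - {{}} \<and> (\<lambda>s. {1..s}) ` S \<subseteq> \<C> \<and>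
     (\<forall>A\<in>\<C>. \<forall>B\<in>\<C>. A \<subseteq> B \<or> B \<subseteq> A)}"

definition invariant_family :: "(nat \<Rightarrow> nat) \<Rightarrow> nat set set \<Rightarrow> bool" where
  "invariant_family \<rho> \<C> \<longleftrightarrow> (\<forall>C\<in>\<C>. \<rho> ` C = C)"

text \<open>The interval that ends at \<open>s\<close> and begins right after the preceding element
  of \<open>S\<close>, or at 1 if there is none.\<close>

definition block :: "nat set \<Rightarrow> nat \<Rightarrow> nat set" where
  "block S s = {y \<in> {1..s}. \<forall>s'\<in>S. s' < s \<longrightarrow> s' < y}"

definition block_points :: "nat set \<Rightarrow> (nat \<Rightarrow> nat) set" where
  "block_points S = Pi\<^sub>E S (block S)"

text \<open>For a chain that refines the prefixes, this concerns the members that end inside the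
  block of \<open>s\<close>: a member not containing \<open>{1..s}\<close> lies within it, and it
  has to miss \<open>x s\<close>.\<close>

definition avoids :: "nat set \<Rightarrow> (nat \<Rightarrow> nat) \<Rightarrow> nat set set \<Rightarrow> bool" where
  "avoids S x \<C> \<longleftrightarrow> (\<forall>C\<in>\<C>. \<forall>s\<in>S. x s \<in> C \<longrightarrow> {1..s} \<subseteq> C)"

lemma prefix_chainsD:
  assumes "\<C> \<in> prefix_chains n S"
  shows "finite \<C>" "\<And>C. C \<in> \<C> \<Longrightarrow> C \<subseteq> {1..n}" "\<And>C. C \<in> \<C> \<Longrightarrow> finite C"
    "\<And>C. C \<in> \<C> \<Longrightarrow> C \<noteq> {}" "\<And>s. s \<in> S \<Longrightarrow> {1..s} \<in> \<C>"
    "\<And>A B. A \<in> \<C> \<Longrightarrow> B \<in> \<C> \<Longrightarrow> A \<subseteq> B \<or> B \<subseteq> A"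
proof -
  have sub: "\<C> \<subseteq> Pow {1..n}" using assms by (auto simp: prefix_chains_def)
  then show "finite \<C>" by (rule finite_subset) simp
  show C: "C \<subseteq> {1..n}" if "C \<in> \<C>" for C using sub that by blast
  show "finite C" if "C \<in> \<C>" for C by (rule finite_subset[OF C[OF that]]) simp
qed (use assms in \<open>unfold prefix_chains_def, blast+\<close>)

lemma finite_prefix_chains: "finite (prefix_chains n S)"
  by (rule finite_subset[of _ "Pow (Pow {1..n})"]) (auto simp: prefix_chains_def)

lemma inj_on_card_prefix_chain:
  assumes "\<C> \<in> prefix_chains n S"
  shows "inj_on card \<C>"
proof (rule inj_onI)
  fix A B assume AB: "A \<in> \<C>" "B \<in> \<C>" "card A = card B"
  show "A = B"
    using prefix_chainsD(6)[OF assms AB(1,2)]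
      card_subset_eq[OF prefix_chainsD(3)[OF assms AB(1)], of B]
      card_subset_eq[OF prefix_chainsD(3)[OF assms AB(2)], of A] AB(3) by auto
qed

text \<open>Elements are sorted by the number of members that omit them: in a chain, the elements of
  any member \<open>C\<close> come before those outside \<open>C\<close>, so they fill the first
  \<open>card C\<close> places.\<close>

lemma ex_permutation_of_chain:
  assumes "\<C> \<subseteq> Pow {1..n}" "\<And>A B. A \<in> \<C> \<Longrightarrow> B \<in> \<C> \<Longrightarrow> A \<subseteq> B \<or> B \<subseteq> A"
  obtains h where "h permutes {1..n}" "\<And>C. C \<in> \<C> \<Longrightarrow> h ` {1..card C} = C"
proof -
  define key where "key y = card {C \<in> \<C>. y \<notin> C}" for y
  have fin: "finite \<C>" by (rule finite_subset[OF assms(1)]) simp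
  have key: "key y < key z" if "C \<in> \<C>" "y \<in> C" "z \<notin> C" for C y z
  proof -
    have "{C \<in> \<C>. y \<notin> C} \<subset> {C \<in> \<C>. z \<notin> C}" using that assms(2) by blast
    then show ?thesis unfolding key_def by (intro psubset_card_mono) (use fin in simp_all)
  qed
  obtain h where h: "h permutes {1..n}" and sorted: "\<And>i j. 1 \<le> i \<Longrightarrow> i < j \<Longrightarrow> j \<le> n \<Longrightarrow>
      key (h i) < key (h j) \<or> key (h i) = key (h j) \<and> h i < h j"
    using stable_sort_permutation[of n key] by blast
  have "h ` {1..card C} = C" if C: "C \<in> \<C>" for C
  proof (rule ccontr)
    assume neq: "h ` {1..card C} \<noteq> C"
    have Cn: "C \<subseteq> {1..n}" using C assms(1) by blast
    then have finC: "finite C" by (rule finite_subset) simp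
    have le: "card C \<le> n" using card_mono[OF _ Cn] by simp
    have card: "card (h ` {1..card C}) = card C"
      using card_image[OF inj_on_subset[OF permutes_inj[OF h] subset_UNIV], of "{1..card C}"] by simp
    have "\<not> h ` {1..card C} \<subseteq> C" using card_subset_eq[OF finC _ card] neq by blast
    then obtain i where i: "i \<in> {1..card C}" "h i \<notin> C" by blast
    have "\<not> C \<subseteq> h ` {1..card C}"
      using card_subset_eq[of "h ` {1..card C}" C] card neq by auto
    then obtain y where y: "y \<in> C" "y \<notin> h ` {1..card C}" by blast
    define j where "j = inv h y"
    have hj: "h j = y" unfolding j_def using h by (simp add: permutes_inverses)
    have "y \<in> {1..n}" using y Cn by blast
    then have "j \<in> {1..n}" unfolding j_def using permutes_inv[OF h] by (simp only: permutes_in_image)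
    moreover have "j \<notin> {1..card C}" using y(2) hj by blast
    ultimately have "i < j" "j \<le> n" "1 \<le> i" using i by auto
    then have "key (h i) \<le> key y" using sorted[of i j] hj by auto
    moreover have "key y < key (h i)" using key[OF C y(1) i(2)] .
    ultimately show False by simp
  qed
  with h show ?thesis by (rule that)
qed

lemma card_prefix_image:
  assumes "h permutes {1..n}"
  shows "card (h ` {1..e}) = e"
  using card_image[OF inj_on_subset[OF permutes_inj[OF assms] subset_UNIV], of "{1..e}"] by simp

text \<open>The chains whose members have the sizes in \<open>E\<close> form a single orbit of
  \<open>Y\<^sub>S\<close>, namely that of the chain of prefixes. A permutation that straightens
  such a chain lies in \<open>Y\<^sub>S\<close> because the prefixes with ends in \<open>S\<close>
  are themselves members.\<close>

lemma chain_of_type_iff: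
  assumes "S \<subseteq> E" "E \<subseteq> {1..n}"
  shows "\<C> \<in> prefix_chains n S \<and> card ` \<C> = E \<longleftrightarrow>
    (\<exists>h\<in>prefix_stabilizer n S. \<C> = (\<lambda>e. h ` {1..e}) ` E)"
proof
  assume *: "\<C> \<in> prefix_chains n S \<and> card ` \<C> = E"
  then have C: "\<C> \<in> prefix_chains n S" and E: "card ` \<C> = E" by auto
  have "\<C> \<subseteq> Pow {1..n}" using prefix_chainsD(2)[OF C] by blast
  then obtain h where h: "h permutes {1..n}" "\<And>C. C \<in> \<C> \<Longrightarrow> h ` {1..card C} = C"
    using ex_permutation_of_chain prefix_chainsD(6)[OF C] by metis
  have "h ` {1..s} = {1..s}" if "s \<in> S" for s
    using h(2)[OF prefix_chainsD(5)[OF C that]] by simp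
  then have "h \<in> prefix_stabilizer n S" using h(1) by (simp add: prefix_stabilizer_def)
  moreover have "(\<lambda>e. h ` {1..e}) ` E = \<C>"
    unfolding E[symmetric] image_image using h(2) by simp
  ultimately show "\<exists>h\<in>prefix_stabilizer n S. \<C> = (\<lambda>e. h ` {1..e}) ` E" by blast
next
  assume "\<exists>h\<in>prefix_stabilizer n S. \<C> = (\<lambda>e. h ` {1..e}) ` E"
  then obtain h where h: "h permutes {1..n}" "\<And>s. s \<in> S \<Longrightarrow> h ` {1..s} = {1..s}"
    and C: "\<C> = (\<lambda>e. h ` {1..e}) ` E" by (auto simp: prefix_stabilizer_def)
  have type: "card ` \<C> = E" unfolding C image_image card_prefix_image[OF h(1)] by simp
  have members: "C \<subseteq> {1..n}" "C \<noteq> {}" if C_in: "C \<in> \<C>" for C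
  proof -
    obtain e where e: "e \<in> E" "C = h ` {1..e}" using C_in unfolding C by blast
    then have "e \<in> {1..n}" using assms(2) by blast
    then have "{1..e} \<subseteq> {1..n}" "{1..e} \<noteq> {}" by auto
    then show "C \<subseteq> {1..n}" "C \<noteq> {}"
      unfolding e(2) using image_mono[of "{1..e}" "{1..n}" h] permutes_image[OF h(1)] by simp_all
  qed
  have prefixes: "(\<lambda>s. {1..s}) ` S \<subseteq> \<C>"
  proof (rule image_subsetI)
    fix s assume s: "s \<in> S"
    then have "{1..s} = h ` {1..s}" using h(2) by simp
    with s assms(1) show "{1..s} \<in> \<C>" unfolding C by blast
  qed
  have comparable: "A \<subseteq> B \<or> B \<subseteq> A" if AB: "A \<in> \<C>" "B \<in> \<C>" for A B
  proof -
    obtain a b where "A = h ` {1..a}" "B = h ` {1..b}" using AB unfolding C by blast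
    then show ?thesis using image_mono[of "{1..a}" "{1..b}" h] image_mono[of "{1..b}" "{1..a}" h]
      by (cases "a \<le> b") auto
  qed
  have "\<C> \<subseteq> Pow {1..n} - {{}}" using members by blast
  with type prefixes comparable show "\<C> \<in> prefix_chains n S \<and> card ` \<C> = E"
    unfolding prefix_chains_def by (intro conjI CollectI ballI)
qed

text \<open>Orbit-stabilizer for the transitive action of \<open>Y\<^sub>S\<close> on these chains;
  the stabilizer of the chain of prefixes is \<open>Y\<^sub>E\<close>, as the sizes tell the members
  apart.\<close>

lemma card_chains_of_type:
  assumes "S \<subseteq> E" "E \<subseteq> {1..n}"
  shows "card {\<C> \<in> prefix_chains n S. card ` \<C> = E} * card (prefix_stabilizer n E) =
    card (prefix_stabilizer n S)"
proof -
  let ?chain = "\<lambda>h. (\<lambda>e. h ` {1..e}) ` E"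
  let ?Y = "prefix_stabilizer n"
  have image: "{\<C> \<in> prefix_chains n S. card ` \<C> = E} = ?chain ` ?Y S"
    by (rule set_eqI) (simp only: mem_Collect_eq image_iff chain_of_type_iff[OF assms])
  have fibre: "card {h \<in> ?Y S. ?chain h = \<C>} = card (?Y E)" if C_in: "\<C> \<in> ?chain ` ?Y S" for \<C>
  proof -
    obtain h0 where h0: "h0 \<in> ?Y S" "?chain h0 = \<C>" using C_in by blast
    have h0p: "h0 permutes {1..n}" using h0(1) by (simp add: prefix_stabilizer_def)
    have "bij_betw (\<lambda>s. h0 \<circ> s) (?Y E) {h \<in> ?Y S. ?chain h = \<C>}"
    proof (rule bij_betw_byWitness[where f' = "\<lambda>h. inv h0 \<circ> h"])
      show "\<forall>s\<in>?Y E. inv h0 \<circ> (h0 \<circ> s) = s" "\<forall>h\<in>{h \<in> ?Y S. ?chain h = \<C>}. h0 \<circ> (inv h0 \<circ> h) = h"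
        using h0p by (auto simp: fun_eq_iff permutes_inverses)
      show "(\<lambda>s. h0 \<circ> s) ` ?Y E \<subseteq> {h \<in> ?Y S. ?chain h = \<C>}"
      proof (rule image_subsetI)
        fix s assume s: "s \<in> ?Y E"
        then have sE: "s ` {1..e} = {1..e}" if "e \<in> E" for e using that by (simp add: prefix_stabilizer_def)
        have "s permutes {1..n}" using s by (simp add: prefix_stabilizer_def)
        then have perm: "h0 \<circ> s permutes {1..n}" using h0p by (simp add: permutes_compose)
        have eq: "(h0 \<circ> s) ` {1..e} = h0 ` {1..e}" if "e \<in> E" for e
          using sE[OF that] by (simp only: image_comp[symmetric])
        have "(h0 \<circ> s) ` {1..e} = {1..e}" if "e \<in> S" for e
          using eq[of e] h0(1) that assms(1) by (simp add: prefix_stabilizer_def subset_iff)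
        then have "h0 \<circ> s \<in> ?Y S" using perm unfolding prefix_stabilizer_def by blast
        moreover have "?chain (h0 \<circ> s) = ?chain h0" by (rule image_cong[OF refl eq])
        ultimately show "h0 \<circ> s \<in> {h \<in> ?Y S. ?chain h = \<C>}" using h0(2) by simp
      qed
      show "(\<lambda>h. inv h0 \<circ> h) ` {h \<in> ?Y S. ?chain h = \<C>} \<subseteq> ?Y E"
      proof (rule image_subsetI)
        fix h assume "h \<in> {h \<in> ?Y S. ?chain h = \<C>}"
        then have h: "h permutes {1..n}" "?chain h = ?chain h0"
          using h0(2) by (auto simp: prefix_stabilizer_def)
        have "(inv h0 \<circ> h) ` {1..e} = {1..e}" if e: "e \<in> E" for e
        proof -
          have "h ` {1..e} \<in> ?chain h0" using e unfolding h(2)[symmetric] by blast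
          then obtain e' where e': "h ` {1..e} = h0 ` {1..e'}" by blast
          then have "e = e'" using card_prefix_image[OF h(1), of e] card_prefix_image[OF h0p, of e'] by simp
          with e' have "(inv h0 \<circ> h) ` {1..e} = (inv h0 \<circ> h0) ` {1..e}" by (simp only: image_comp[symmetric])
          also have "inv h0 \<circ> h0 = id" using h0p by (simp add: permutes_inv_o)
          finally show ?thesis by simp
        qed
        then show "inv h0 \<circ> h \<in> ?Y E" using h(1) h0p
          by (simp add: prefix_stabilizer_def permutes_compose permutes_inv)
      qed
    qed
    then show ?thesis by (rule bij_betw_same_card[symmetric])
  qed
  have "card (?Y S) = (\<Sum>\<C>\<in>?chain ` ?Y S. card {h \<in> ?Y S. ?chain h = \<C>})"
    by (rule card_eq_sum_card_fibres) (rule finite_prefix_stabilizer)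
  also have "\<dots> = (\<Sum>\<C>\<in>?chain ` ?Y S. card (?Y E))" by (rule sum.cong[OF refl fibre])
  finally show ?thesis unfolding image by simp
qed

lemma prefix_stabilizerD:
  assumes "g \<in> prefix_stabilizer n S"
  shows "g permutes {1..n}" "\<And>s. s \<in> S \<Longrightarrow> g ` {1..s} = {1..s}"
  using assms by (auto simp: prefix_stabilizer_def)

lemma inv_image_eq_iff:
  assumes "bij h"
  shows "inv h ` A = B \<longleftrightarrow> A = h ` B"
  using assms by (metis bij_is_inj bij_is_surj image_inv_f_f image_f_inv_f)

lemma prefix_stabilizer_inv:
  assumes "g \<in> prefix_stabilizer n S"
  shows "inv g \<in> prefix_stabilizer n S"
  using prefix_stabilizerD[OF assms]
  by (simp add: prefix_stabilizer_def permutes_inv inv_image_eq_iff[OF permutes_bij[of g "{1..n}"]])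

lemma prefix_stabilizer_block:
  assumes "g \<in> prefix_stabilizer n S" "s \<in> S" "y \<in> block S s"
  shows "g y \<in> block S s"
proof -
  have mem: "g y \<in> {1..s'} \<longleftrightarrow> y \<in> {1..s'}" if "s' \<in> S" for s'
    using prefix_stabilizerD[OF assms(1)] that permutes_inj inj_image_mem_iff by metis
  have "g y \<in> {1..s}" using mem[OF assms(2)] assms(3) by (simp add: block_def)
  moreover have "s' < g y" if "s' \<in> S" "s' < s" for s'
    using mem[OF that(1)] that assms(3) \<open>g y \<in> {1..s}\<close> by (auto simp: block_def)
  ultimately show ?thesis by (simp add: block_def)
qed

lemma block_point_bounds:
  assumes "x \<in> block_points S" "s \<in> S"
  shows "x s \<in> block S s" "1 \<le> x s" "x s \<le> s" "\<And>s'. s' \<in> S \<Longrightarrow> s' < s \<Longrightarrow> s' < x s"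
proof -
  show "x s \<in> block S s" using assms by (auto simp: block_points_def)
  then show "1 \<le> x s" "x s \<le> s" "\<And>s'. s' \<in> S \<Longrightarrow> s' < s \<Longrightarrow> s' < x s"
    by (auto simp: block_def)
qed

text \<open>Conjugation by \<open>h\<close> carries the moved chain back to the chain of prefixes,
  and it commutes with taking \<open>k\<close>-th powers.\<close>

lemma card_roots_of_invariant_family:
  assumes "h permutes {1..n}"
  shows "card {\<sigma>. \<sigma> permutes {1..n} \<and> invariant_family (\<sigma> ^^ k) ((\<lambda>e. h ` {1..e}) ` E)} =
    card {\<sigma>. \<sigma> permutes {1..n} \<and> \<sigma> ^^ k \<in> prefix_stabilizer n E}"
proof (rule bij_betw_same_card[OF bij_betw_byWitness
      [where f = "\<lambda>\<sigma>. inv h \<circ> \<sigma> \<circ> h" and f' = "\<lambda>\<sigma>. h \<circ> \<sigma> \<circ> inv h"]])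
  let ?A = "{\<sigma>. \<sigma> permutes {1..n} \<and> invariant_family (\<sigma> ^^ k) ((\<lambda>e. h ` {1..e}) ` E)}"
  let ?B = "{\<sigma>. \<sigma> permutes {1..n} \<and> \<sigma> ^^ k \<in> prefix_stabilizer n E}"
  have bij: "bij h" using assms by (rule permutes_bij)
  have inv: "inv h permutes {1..n}" using assms by (rule permutes_inv)
  have iff: "(inv h \<circ> \<sigma> \<circ> h) ^^ k \<in> prefix_stabilizer n E \<longleftrightarrow>
      invariant_family (\<sigma> ^^ k) ((\<lambda>e. h ` {1..e}) ` E)" if "\<sigma> permutes {1..n}" for \<sigma>
  proof -
    have "inv h \<circ> \<sigma> ^^ k \<circ> h permutes {1..n}"
      using assms inv permutes_funpow[OF that] by (simp add: permutes_compose)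
    moreover have "(inv h \<circ> \<sigma> ^^ k \<circ> h) ` {1..e} = {1..e} \<longleftrightarrow> (\<sigma> ^^ k) ` (h ` {1..e}) = h ` {1..e}" for e
      unfolding image_comp[symmetric] by (rule inv_image_eq_iff[OF bij])
    ultimately show ?thesis
      unfolding conjugate_funpow[OF bij] prefix_stabilizer_def invariant_family_def by simp
  qed
  show hinv: "\<forall>\<sigma>\<in>?A. h \<circ> (inv h \<circ> \<sigma> \<circ> h) \<circ> inv h = \<sigma>" "\<forall>\<sigma>\<in>?B. inv h \<circ> (h \<circ> \<sigma> \<circ> inv h) \<circ> h = \<sigma>"
    using assms by (auto simp: fun_eq_iff permutes_inverses)
  show "(\<lambda>\<sigma>. inv h \<circ> \<sigma> \<circ> h) ` ?A \<subseteq> ?B"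
  proof (rule image_subsetI)
    fix \<sigma> assume "\<sigma> \<in> ?A"
    then have \<sigma>: "\<sigma> permutes {1..n}" "invariant_family (\<sigma> ^^ k) ((\<lambda>e. h ` {1..e}) ` E)" by auto
    then show "inv h \<circ> \<sigma> \<circ> h \<in> ?B"
      using iff[OF \<sigma>(1)] assms inv by (simp add: permutes_compose)
  qed
  show "(\<lambda>\<sigma>. h \<circ> \<sigma> \<circ> inv h) ` ?B \<subseteq> ?A"
  proof (rule image_subsetI)
    fix \<sigma> assume \<sigma>: "\<sigma> \<in> ?B"
    then have perm: "h \<circ> \<sigma> \<circ> inv h permutes {1..n}" using assms inv by (simp add: permutes_compose)
    have "inv h \<circ> (h \<circ> \<sigma> \<circ> inv h) \<circ> h = \<sigma>" using hinv(2) \<sigma> by blast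
    with iff[OF perm] \<sigma> perm show "h \<circ> \<sigma> \<circ> inv h \<in> ?A" by simp
  qed
qed

text \<open>A permutation in \<open>Y\<^sub>S\<close> maps each block and each prefix with end in
  \<open>S\<close> onto itself, so it transports choices of block points together with the
  chain.\<close>

lemma card_avoiding_block_points:
  assumes "h \<in> prefix_stabilizer n S"
  shows "card {x \<in> block_points S. avoids S x ((\<lambda>e. h ` {1..e}) ` E)} =
    card {x \<in> block_points S. avoids S x ((\<lambda>e. {1..e}) ` E)}"
proof (rule bij_betw_same_card[OF bij_betw_byWitness
      [where f = "\<lambda>x. restrict (\<lambda>s. inv h (x s)) S" and f' = "\<lambda>x. restrict (\<lambda>s. h (x s)) S"]])
  let ?A = "{x \<in> block_points S. avoids S x ((\<lambda>e. h ` {1..e}) ` E)}"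
  let ?B = "{x \<in> block_points S. avoids S x ((\<lambda>e. {1..e}) ` E)}"
  note h = prefix_stabilizerD[OF assms]
  have pts: "restrict (\<lambda>s. g (x s)) S \<in> block_points S"
    if "x \<in> block_points S" "g \<in> prefix_stabilizer n S" for x g
    using that prefix_stabilizer_block[OF that(2)] unfolding block_points_def by (auto simp: PiE_iff)
  have h_inv: "h (inv h y) = y" "inv h (h y) = y" for y using h(1) by (auto simp: permutes_inverses)
  have cancel: "restrict (\<lambda>s. f (restrict (\<lambda>s. g (x s)) S s)) S = x"
    if "x \<in> block_points S" "\<And>y. f (g y) = y" for x and f g :: "nat \<Rightarrow> nat"
  proof -
    have "restrict (\<lambda>s. f (restrict (\<lambda>s. g (x s)) S s)) S = restrict x S"
      using that(2) by (simp cong: restrict_cong)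
    also have "\<dots> = x" using that(1) unfolding block_points_def by (rule PiE_restrict)
    finally show ?thesis .
  qed
  show "\<forall>x\<in>?A. restrict (\<lambda>s. h (restrict (\<lambda>s. inv h (x s)) S s)) S = x"
    "\<forall>x\<in>?B. restrict (\<lambda>s. inv h (restrict (\<lambda>s. h (x s)) S s)) S = x"
    using cancel[where f = h and g = "inv h"] cancel[where f = "inv h" and g = h] h_inv by blast+
  have avoids_iff: "avoids S (restrict (\<lambda>s. h (x s)) S) ((\<lambda>e. h ` {1..e}) ` E) \<longleftrightarrow>
      avoids S x ((\<lambda>e. {1..e}) ` E)" for x
  proof -
    have "(restrict (\<lambda>s. h (x s)) S s \<in> h ` {1..e} \<longrightarrow> {1..s} \<subseteq> h ` {1..e}) \<longleftrightarrow>
        (x s \<in> {1..e} \<longrightarrow> {1..s} \<subseteq> {1..e})" if s: "s \<in> S" for s e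
    proof -
      have "h (x s) \<in> h ` {1..e} \<longleftrightarrow> x s \<in> {1..e}"
        by (rule inj_image_mem_iff[OF permutes_inj[OF h(1)]])
      moreover have "{1..s} \<subseteq> h ` {1..e} \<longleftrightarrow> {1..s} \<subseteq> {1..e}"
        using inj_image_subset_iff[OF permutes_inj[OF h(1)], of "{1..s}" "{1..e}"] h(2)[OF s]
        by (simp only:)
      ultimately show ?thesis by (simp only: restrict_apply s if_True)
    qed
    then show ?thesis unfolding avoids_def ball_simps(9) by (intro ball_cong refl)
  qed
  show "(\<lambda>x. restrict (\<lambda>s. inv h (x s)) S) ` ?A \<subseteq> ?B"
  proof (rule image_subsetI)
    fix x assume x: "x \<in> ?A"
    have "restrict (\<lambda>s. h (restrict (\<lambda>s. inv h (x s)) S s)) S = x"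
      by (rule cancel) (use x h_inv in auto)
    then show "restrict (\<lambda>s. inv h (x s)) S \<in> ?B"
      using x avoids_iff[of "restrict (\<lambda>s. inv h (x s)) S"] pts[OF _ prefix_stabilizer_inv[OF assms]]
      by simp
  qed
  show "(\<lambda>x. restrict (\<lambda>s. h (x s)) S) ` ?B \<subseteq> ?A"
  proof (rule image_subsetI)
    fix x assume "x \<in> ?B"
    then show "restrict (\<lambda>s. h (x s)) S \<in> ?A" using avoids_iff[of x] pts[OF _ assms, of x] by simp
  qed
qed

text \<open>The summand is constant on chains of one type. The factor \<open>|Y\<^sub>E|\<close>
  from the count of roots combines with the number of chains to \<open>|Y\<^sub>S|\<close>, which no
  longer depends on \<open>E\<close>.\<close>

lemma sum_over_chains_of_type:
  assumes "0 < k" "S \<subseteq> E" "E \<subseteq> {1..n}"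
  shows "(\<Sum>\<C> | \<C> \<in> prefix_chains n S \<and> card ` \<C> = E.
      card {\<sigma>. \<sigma> permutes {1..n} \<and> invariant_family (\<sigma> ^^ k) \<C>} *
      card {x \<in> block_points S. avoids S x \<C>}) =
    card (prefix_stabilizer n S) * card (descent_roots n k E) *
      card {x \<in> block_points S. avoids S x ((\<lambda>e. {1..e}) ` E)}"
    (is "sum ?f ?Ch = _ * _ * ?X")
proof -
  have "?f \<C> = card (prefix_stabilizer n E) * card (descent_roots n k E) * ?X" if \<C>: "\<C> \<in> ?Ch" for \<C>
  proof -
    have "\<exists>h\<in>prefix_stabilizer n S. \<C> = (\<lambda>e. h ` {1..e}) ` E"
      using \<C> unfolding mem_Collect_eq chain_of_type_iff[OF assms(2,3)] .
    then obtain h where h: "h \<in> prefix_stabilizer n S" "\<C> = (\<lambda>e. h ` {1..e}) ` E" by blast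
    show ?thesis
      unfolding h(2) card_roots_of_invariant_family[OF prefix_stabilizerD(1)[OF h(1)]]
        card_avoiding_block_points[OF h(1)] card_powers_in_prefix_stabilizer[OF assms(1,3)] ..
  qed
  then have "sum ?f ?Ch = (\<Sum>\<C>\<in>?Ch. card (prefix_stabilizer n E) * card (descent_roots n k E) * ?X)"
    by (rule sum.cong[OF refl])
  also have "\<dots> = (card ?Ch * card (prefix_stabilizer n E)) * card (descent_roots n k E) * ?X"
    by (simp only: sum_constant of_nat_id mult.assoc)
  finally show ?thesis unfolding card_chains_of_type[OF assms(2,3)] .
qed

lemma orbit_subset_block:
  assumes "\<rho> \<in> prefix_stabilizer n S" "s \<in> S" "y \<in> block S s"
  shows "orbit \<rho> y \<subseteq> block S s"
proof
  fix z assume "z \<in> orbit \<rho> y"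
  then show "z \<in> block S s"
    by induction (use assms prefix_stabilizer_block[OF assms(1,2)] in auto)
qed

lemma orbit_subset_invariant:
  assumes "\<rho> ` C = C" "y \<in> C"
  shows "orbit \<rho> y \<subseteq> C"
proof
  fix z assume "z \<in> orbit \<rho> y"
  then show "z \<in> C" by induction (use assms in blast)+
qed

section \<open>The signed sum over invariant chains\<close>

lemma block_of:
  assumes "finite S" "n \<in> S" "y \<in> {1..n}"
  obtains s where "s \<in> S" "y \<in> block S s"
proof -
  let ?s = "Min {s \<in> S. y \<le> s}"
  have s: "?s \<in> {s \<in> S. y \<le> s}" by (rule Min_in) (use assms in auto)
  have "s' < y" if "s' \<in> S" "s' < ?s" for s'
  proof (rule ccontr)
    assume "\<not> s' < y"
    then have "?s \<le> s'" using that assms(1) by (intro Min_le) auto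
    with that show False by simp
  qed
  then have "y \<in> block S ?s" using s assms(3) by (simp add: block_def)
  with s that show ?thesis by blast
qed

lemma prefix_image_in_prefix_chains:
  assumes "S \<subseteq> {1..n}"
  shows "(\<lambda>s. {1..s}) ` S \<in> prefix_chains n S"
proof -
  have "{1..s} \<subseteq> {1..n} \<and> {1..s} \<noteq> {}" if "s \<in> S" for s :: nat
    using subsetD[OF assms that] by auto
  moreover have "{1..a} \<subseteq> {1..b} \<or> {1..b} \<subseteq> {1..a}" for a b :: nat
    by (cases "a \<le> b") auto
  ultimately show ?thesis unfolding prefix_chains_def by blast
qed

text \<open>The cancellation for fixed \<open>\<rho>\<close> and \<open>x\<close>. No chain
  qualifies unless \<open>\<rho>\<close> preserves the prefixes. If the orbits of the chosen points
  fill the blocks, no member can end inside a block, and only the chain of prefixes remains.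
  Otherwise one subset can be toggled.\<close>

lemma alternating_sum_invariant_chains:
  assumes S: "n \<in> S" "S \<subseteq> {1..n}" and x: "x \<in> block_points S" and \<rho>: "\<rho> permutes {1..n}"
  shows "(\<Sum>\<C> | \<C> \<in> prefix_chains n S \<and> avoids S x \<C> \<and> invariant_family \<rho> \<C>. (- 1) ^ card \<C>) =
    (if \<rho> \<in> prefix_stabilizer n S \<and> (\<forall>s\<in>S. orbit \<rho> (x s) = block S s)
     then (- 1) ^ card S else (0 :: int))"
    (is "sum ?sgn ?F = _")
proof -
  have fin: "finite S" by (rule finite_subset[OF S(2)]) simp
  have perm: "permutation \<rho>" using \<rho> by (auto simp: permutation_permutes)
  have self: "y \<in> orbit \<rho> y" for y using perm by (rule permutation_self_in_orbit)
  have F: "\<C> \<in> prefix_chains n S" "\<And>C s. C \<in> \<C> \<Longrightarrow> s \<in> S \<Longrightarrow> x s \<in> C \<Longrightarrow> {1..s} \<subseteq> C"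
    "\<And>C. C \<in> \<C> \<Longrightarrow> \<rho> ` C = C" if "\<C> \<in> ?F" for \<C>
    using that by (auto simp: avoids_def invariant_family_def)
  have disj: "z \<notin> C" if "\<rho> ` C = C" "y \<notin> C" "z \<in> orbit \<rho> y" for C y z
  proof -
    have "y \<in> orbit \<rho> z" by (rule orbit_swap[OF self that(3)])
    then show ?thesis using orbit_subset_invariant[OF that(1), of z] that(2) by blast
  qed
  show ?thesis
  proof (cases "\<rho> \<in> prefix_stabilizer n S")
    case False
    have "?F = {}"
    proof (rule ccontr)
      assume "?F \<noteq> {}"
      then obtain \<C> where \<C>: "\<C> \<in> ?F" by blast
      have "\<rho> ` {1..s} = {1..s}" if "s \<in> S" for s
        by (rule F(3)[OF \<C> prefix_chainsD(5)[OF F(1)[OF \<C>] that]])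
      then show False using False \<rho> by (simp add: prefix_stabilizer_def)
    qed
    then show ?thesis using False by (simp only: sum.empty simp_thms if_False)
  next
    case Y: True
    show ?thesis
    proof (cases "\<forall>s\<in>S. orbit \<rho> (x s) = block S s")
      case True
      have "(\<lambda>s. {1..s}) ` S \<in> ?F"
      proof -
        have "{1..s} \<subseteq> {1..s'}" if "s \<in> S" "s' \<in> S" "x s \<in> {1..s'}" for s s'
          using block_point_bounds(4)[OF x that(1,2)] that(3) by (cases "s' < s") auto
        then have "avoids S x ((\<lambda>s. {1..s}) ` S)" unfolding avoids_def by blast
        moreover have "invariant_family \<rho> ((\<lambda>s. {1..s}) ` S)"
          unfolding invariant_family_def using prefix_stabilizerD(2)[OF Y] by blast
        ultimately show ?thesis using prefix_image_in_prefix_chains[OF S(2)] by simp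
      qed
      moreover have "\<C> = (\<lambda>s. {1..s}) ` S" if \<C>: "\<C> \<in> ?F" for \<C>
      proof
        show "(\<lambda>s. {1..s}) ` S \<subseteq> \<C>" using prefix_chainsD(5)[OF F(1)[OF \<C>]] by blast
        show "\<C> \<subseteq> (\<lambda>s. {1..s}) ` S"
        proof
          fix C assume C: "C \<in> \<C>"
          \<comment> \<open>In the smallest prefix around \<open>C\<close> there are two cases:
            \<open>C\<close> contains the chosen point and so fills the prefix, or it misses the
            orbit of that point, hence the whole block, and fits into a smaller prefix.\<close>
          let ?s = "Min {s \<in> S. C \<subseteq> {1..s}}"
          have "n \<in> {s \<in> S. C \<subseteq> {1..s}}" using S(1) prefix_chainsD(2)[OF F(1)[OF \<C>] C] by simp
          then have "?s \<in> {s \<in> S. C \<subseteq> {1..s}}" by (intro Min_in) (use fin in auto)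
          then have s: "?s \<in> S" "C \<subseteq> {1..?s}" by auto
          have least: "?s \<le> s'" if "s' \<in> S" "C \<subseteq> {1..s'}" for s'
            by (rule Min_le) (use that fin in auto)
          show "C \<in> (\<lambda>s. {1..s}) ` S"
          proof (cases "x ?s \<in> C")
            case True
            then have "C = {1..?s}" using F(2)[OF \<C> C s(1)] s(2) by (intro subset_antisym)
            with s(1) show ?thesis by (rule image_eqI[rotated])
          next
            case False
            have outside: "y \<notin> block S ?s" if "y \<in> C" for y
              using disj[OF F(3)[OF \<C> C] False, of y] that bspec[OF True s(1)] by blast
            obtain y where y: "y \<in> C" using prefix_chainsD(4)[OF F(1)[OF \<C>] C] by blast
            have lower: "\<exists>s'\<in>S. s' < ?s \<and> z \<le> s'" if "z \<in> C" for z
              using outside[OF that] subsetD[OF s(2) that] unfolding block_def by (force simp: not_less)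
            let ?t = "Max {s' \<in> S. s' < ?s}"
            have t: "?t \<in> {s' \<in> S. s' < ?s}"
              by (rule Max_in) (use fin lower[OF y] in auto)
            have "C \<subseteq> {1..?t}"
            proof
              fix z assume z: "z \<in> C"
              obtain s' where s': "s' \<in> S" "s' < ?s" "z \<le> s'" using lower[OF z] by blast
              have "s' \<le> ?t" by (rule Max_ge) (use fin s' in auto)
              with s'(3) subsetD[OF s(2) z] show "z \<in> {1..?t}" by simp
            qed
            with least[of ?t] t show ?thesis by simp
          qed
        qed
      qed
      ultimately have "?F = {(\<lambda>s. {1..s}) ` S}" by blast
      moreover have "card ((\<lambda>s. {1..s}) ` S) = card S"
      proof (rule card_image, rule inj_onI)
        fix a b :: nat assume "{1..a} = {1..b}"
        then have "card {1..a} = card {1..b}" by (simp only:)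
        then show "a = b" by simp
      qed
      ultimately show ?thesis using Y True by (simp only: sum.insert sum.empty) simp
    next
      case False
      then obtain s where s: "s \<in> S" "orbit \<rho> (x s) \<noteq> block S s" by blast
      \<comment> \<open>\<open>C0\<close> is the largest proper invariant subset of \<open>{1..s}\<close> avoiding \<open>x s\<close>, hence comparable
        with every member of an admissible chain and free to be added or removed.\<close>
      define C0 where "C0 = {1..s} - orbit \<rho> (x s)"
      have orb: "orbit \<rho> (x s) \<subseteq> block S s"
        by (rule orbit_subset_block[OF Y s(1) block_point_bounds(1)[OF x s(1)]])
      have block_s: "block S s \<subseteq> {1..s}" "\<And>s'. s' \<in> S \<Longrightarrow> s' < s \<Longrightarrow> block S s \<inter> {1..s'} = {}"
        by (auto simp: block_def)
      have xs: "x s \<notin> C0" unfolding C0_def using self by blast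
      \<comment> \<open>Deleting \<open>C0\<close> must not destroy a required prefix. Equality with
        an earlier prefix would make the orbit fill the block; equality with a later one, or with
        \<open>{1..s}\<close>, would put \<open>x s\<close> into \<open>C0\<close>.\<close>
      have C0_not_prefix: "C0 \<noteq> {1..s'}" if "s' \<in> S" for s'
      proof
        assume C0: "C0 = {1..s'}"
        show False
        proof (cases "s' < s")
          case True
          have "block S s \<subseteq> orbit \<rho> (x s)" using block_s(1) block_s(2)[OF that True] C0 C0_def by blast
          with orb s(2) show False by blast
        next
          case False
          then show False using xs C0 block_point_bounds(2,3)[OF x s(1)] by simp
        qed
      qed
      have C0_inv: "\<rho> ` C0 = C0"
      proof -
        have "\<rho> ` orbit \<rho> (x s) = orbit \<rho> (x s)"
        proof (rule endo_inj_surj)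
          show "finite (orbit \<rho> (x s))" by (rule finite_orbit[OF self])
          show "\<rho> ` orbit \<rho> (x s) \<subseteq> orbit \<rho> (x s)" by (auto intro: orbit.step)
          show "inj_on \<rho> (orbit \<rho> (x s))" using permutes_inj[OF \<rho>] by (rule inj_on_subset) simp
        qed
        then show ?thesis unfolding C0_def
          by (simp only: image_set_diff[OF permutes_inj[OF \<rho>]] prefix_stabilizerD(2)[OF Y s(1)])
      qed
      \<comment> \<open>The chosen points inside \<open>C0\<close> belong to earlier blocks, whose
        prefixes are disjoint from the removed orbit.\<close>
      have C0_avoids: "{1..s'} \<subseteq> C0" if s': "s' \<in> S" "x s' \<in> C0" for s'
      proof -
        have "x s' \<le> s" using s'(2) by (simp add: C0_def)
        then have "\<not> s < s'" using block_point_bounds(4)[OF x s'(1) s(1)] by auto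
        moreover have "s' \<noteq> s" using s'(2) xs by blast
        ultimately have "s' < s" by simp
        then show ?thesis unfolding C0_def using orb block_s(2)[OF s'(1)] by fastforce
      qed
      have C0_sub: "C0 \<subseteq> {1..n}"
        unfolding C0_def using subsetD[OF S(2) s(1)] by auto
      have C0_ne: "C0 \<noteq> {}" using orb block_s(1) s(2) unfolding C0_def by blast
      have comparable: "C \<subseteq> C0 \<or> C0 \<subseteq> C" if \<C>: "\<C> \<in> ?F" "C \<in> \<C>" for \<C> C
      proof (cases "{1..s} \<subseteq> C")
        case True
        then show ?thesis unfolding C0_def by blast
      next
        case False
        have "C \<subseteq> {1..s}"
          using prefix_chainsD(6)[OF F(1)[OF \<C>(1)] \<C>(2) prefix_chainsD(5)[OF F(1)[OF \<C>(1)] s(1)]] False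
          by blast
        moreover have "x s \<notin> C" using F(2)[OF \<C> s(1)] False by blast
        ultimately show ?thesis using disj[OF F(3)[OF \<C>], of "x s"] unfolding C0_def by blast
      qed
      have "sum ?sgn ?F = 0"
      proof (rule sum_alternating_toggle_eq_0[where X = C0])
        show "finite ?F" by (rule finite_subset[OF _ finite_prefix_chains[of n S]]) blast
        show "finite \<C>" if "\<C> \<in> ?F" for \<C> by (rule prefix_chainsD(1)[OF F(1)[OF that]])
        show "insert C0 \<C> \<in> ?F" if \<C>: "\<C> \<in> ?F" for \<C>
        proof -
          note D = prefix_chainsD[OF F(1)[OF \<C>]]
          have "insert C0 \<C> \<subseteq> Pow {1..n} - {{}}" using C0_sub C0_ne D(2,4) by blast
          moreover have "(\<lambda>s. {1..s}) ` S \<subseteq> insert C0 \<C>" using D(5) by blast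
          moreover have "\<forall>A\<in>insert C0 \<C>. \<forall>B\<in>insert C0 \<C>. A \<subseteq> B \<or> B \<subseteq> A"
            using comparable[OF \<C>] D(6) by (metis insert_iff order_refl)
          ultimately have "insert C0 \<C> \<in> prefix_chains n S" unfolding prefix_chains_def by (intro CollectI conjI)
          then show ?thesis using \<C> C0_inv C0_avoids by (simp add: avoids_def invariant_family_def)
        qed
        show "\<C> - {C0} \<in> ?F" if \<C>: "\<C> \<in> ?F" for \<C>
        proof -
          note D = prefix_chainsD[OF F(1)[OF \<C>]]
          have "\<C> - {C0} \<subseteq> Pow {1..n} - {{}}" using D(2,4) by blast
          moreover have "(\<lambda>s. {1..s}) ` S \<subseteq> \<C> - {C0}" using D(5) C0_not_prefix by blast
          moreover have "\<forall>A\<in>\<C> - {C0}. \<forall>B\<in>\<C> - {C0}. A \<subseteq> B \<or> B \<subseteq> A" using D(6) by blast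
          ultimately have "\<C> - {C0} \<in> prefix_chains n S" unfolding prefix_chains_def by (intro CollectI conjI)
          then show ?thesis using \<C> by (simp add: avoids_def invariant_family_def)
        qed
      qed
      then show ?thesis using False by (simp only: simp_thms if_False)
    qed
  qed
qed

section \<open>Signed sums over the descent sets of roots of the identity\<close>

text \<open>The ends of the prefixes that \<open>avoids\<close> admits. Within the block of
  \<open>s\<close> they are the positions before \<open>x s\<close>, together with \<open>s\<close>
  itself.\<close>

definition allowed_ends :: "nat \<Rightarrow> nat set \<Rightarrow> (nat \<Rightarrow> nat) \<Rightarrow> nat set" where
  "allowed_ends n S x = {j \<in> {1..n}. \<forall>s\<in>S. x s \<le> j \<longrightarrow> s \<le> j}"

definition block_cyclic_perms :: "nat \<Rightarrow> nat set \<Rightarrow> (nat \<Rightarrow> nat) \<Rightarrow> (nat \<Rightarrow> nat) set" where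
  "block_cyclic_perms n S x =
     {\<rho> \<in> prefix_stabilizer n S. \<forall>s\<in>S. orbit \<rho> (x s) = block S s}"

text \<open>The condition will turn out to be unimodality on the blocks, with \<open>x s\<close> the
  place of the minimum. The sign also counts the elements of \<open>S\<close>, which gives a global
  factor \<open>(- 1) ^ card S\<close>.\<close>

definition signed_descent_sum :: "nat \<Rightarrow> nat set \<Rightarrow> nat \<Rightarrow> int" where
  "signed_descent_sum n S k = (\<Sum>\<tau>\<in>identity_roots n k.
     if S \<union> descent_set n \<tau> \<in> allowed_ends n S ` block_points S
     then (- 1) ^ card (S \<union> descent_set n \<tau>) else 0)"

lemma avoids_prefixes_iff:
  assumes "E \<subseteq> {1..n}" "x \<in> block_points S"
  shows "avoids S x ((\<lambda>e. {1..e}) ` E) \<longleftrightarrow> E \<subseteq> allowed_ends n S x"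
proof -
  have "(x s \<in> {1..e} \<longrightarrow> {1..s} \<subseteq> {1..e}) \<longleftrightarrow> (x s \<le> e \<longrightarrow> s \<le> e)" if "s \<in> S" for s e
    using block_point_bounds(2,3)[OF assms(2) that] by auto
  then have "avoids S x ((\<lambda>e. {1..e}) ` E) \<longleftrightarrow> (\<forall>e\<in>E. \<forall>s\<in>S. x s \<le> e \<longrightarrow> s \<le> e)"
    unfolding avoids_def ball_simps(9) by (intro ball_cong refl)
  also have "\<dots> \<longleftrightarrow> E \<subseteq> allowed_ends n S x"
    using assms(1) by (auto simp: allowed_ends_def)
  finally show ?thesis .
qed

text \<open>Only the point of the block of \<open>j\<close> matters: blocks before it end before
  \<open>j\<close>, and the chosen points of blocks after it exceed \<open>j\<close>.\<close>

lemma block_point_allowed_iff: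
  assumes "x \<in> block_points S" "s \<in> S" "s \<le> n" "j \<in> block S s" "j < s"
  shows "j \<in> allowed_ends n S x \<longleftrightarrow> j < x s"
proof
  assume "j \<in> allowed_ends n S x"
  then have "x s \<le> j \<Longrightarrow> s \<le> j" using assms(2) by (auto simp: allowed_ends_def)
  then show "j < x s" using assms(5) by force
next
  assume j: "j < x s"
  have "s' \<le> j" if s': "s' \<in> S" "x s' \<le> j" for s'
  proof -
    have "s' < s"
    proof (rule ccontr)
      assume "\<not> s' < s"
      then consider "s' = s" | "s < s'" by linarith
      then show False
      proof cases
        case 2
        then have "s < x s'" using block_point_bounds(4)[OF assms(1) s'(1) assms(2)] by simp
        then show False using s'(2) assms(5) by simp
      qed (use s' j in simp)
    qed
    then show ?thesis using assms(4) s'(1) by (auto simp: block_def)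
  qed
  then show "j \<in> allowed_ends n S x" using assms(3-5) by (simp add: allowed_ends_def block_def)
qed

lemma subset_allowed_ends:
  assumes "S \<subseteq> {1..n}" "x \<in> block_points S"
  shows "S \<subseteq> allowed_ends n S x"
proof
  fix j assume j: "j \<in> S"
  have "s \<le> j" if "s \<in> S" "x s \<le> j" for s
    using block_point_bounds(4)[OF assms(2) that(1) j] that(2) by (cases "j < s") auto
  then show "j \<in> allowed_ends n S x" using j assms(1) by (auto simp: allowed_ends_def)
qed

text \<open>If \<open>a s < b s\<close>, then the position \<open>a s\<close> is allowed for
  \<open>b\<close> but not for \<open>a\<close>. Hence a given set of positions arises from at most
  one choice of points.\<close>

lemma inj_on_allowed_ends:
  assumes "S \<subseteq> {1..n}"
  shows "inj_on (allowed_ends n S) (block_points S)"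
proof (rule inj_onI)
  fix x y assume x: "x \<in> block_points S" and y: "y \<in> block_points S"
    and eq: "allowed_ends n S x = allowed_ends n S y"
  have not_less: "\<not> a s < b s"
    if "a \<in> block_points S" "b \<in> block_points S" "allowed_ends n S a = allowed_ends n S b" "s \<in> S" for a b s
  proof
    assume less: "a s < b s"
    have "s \<le> n" using assms that(4) by auto
    have "a s < s" using less block_point_bounds(3)[OF that(2,4)] by simp
    from block_point_allowed_iff[OF that(1,4) \<open>s \<le> n\<close> block_point_bounds(1)[OF that(1,4)] this]
      block_point_allowed_iff[OF that(2,4) \<open>s \<le> n\<close> block_point_bounds(1)[OF that(1,4)] this]
    show False using less that(3) by simp
  qed
  have "x s = y s" if "s \<in> S" for s
    using not_less[OF x y eq that] not_less[OF y x eq[symmetric] that] by simp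
  then show "x = y" using x y unfolding block_points_def by (rule PiE_ext[rotated 2])
qed

lemma finite_block_points: "finite S \<Longrightarrow> finite (block_points S)"
  unfolding block_points_def by (rule finite_PiE) (auto simp: block_def)

text \<open>Both cardinalities are expanded into sums of indicators over \<open>\<tau>\<close> and
  \<open>x\<close>, and the sum over \<open>E\<close> is carried out first.\<close>

lemma signed_descent_sum_eq:
  assumes S: "S \<subseteq> {1..n}"
  shows "signed_descent_sum n S k =
    (\<Sum>E | S \<subseteq> E \<and> E \<subseteq> {1..n}. (- 1) ^ card E * int (card (descent_roots n k E)) *
      int (card {x \<in> block_points S. avoids S x ((\<lambda>e. {1..e}) ` E)}))"
proof -
  let ?X = "block_points S" and ?I = "identity_roots n k" and ?Des = "descent_set n"
  let ?EE = "{E. S \<subseteq> E \<and> E \<subseteq> {1..n}}"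
  have finS: "finite S" by (rule finite_subset[OF S]) simp
  have finX: "finite ?X" using finS by (rule finite_block_points)
  have finEE: "finite ?EE" by (rule finite_subset[of _ "Pow {1..n}"]) auto
  have card_roots: "int (card (descent_roots n k E)) = (\<Sum>\<tau>\<in>?I. if ?Des \<tau> \<subseteq> E then 1 else 0)" for E
    by (simp add: descent_roots_def finite_identity_roots flip: sum.inter_filter)
  have card_points: "int (card {x \<in> ?X. avoids S x ((\<lambda>e. {1..e}) ` E)}) =
      (\<Sum>x\<in>?X. if E \<subseteq> allowed_ends n S x then 1 else 0)" if "E \<in> ?EE" for E
  proof -
    have "{x \<in> ?X. avoids S x ((\<lambda>e. {1..e}) ` E)} = {x \<in> ?X. E \<subseteq> allowed_ends n S x}"
      using avoids_prefixes_iff that by blast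
    then show ?thesis by (simp add: finX flip: sum.inter_filter)
  qed
  \<comment> \<open>The admissible \<open>E\<close> form the Boolean interval from
    \<open>S \<union> ?Des \<tau>\<close> to \<open>allowed_ends n S x\<close>, whose alternating
    sum vanishes unless the two ends coincide.\<close>
  have inner: "(\<Sum>E\<in>?EE. if ?Des \<tau> \<subseteq> E \<and> E \<subseteq> allowed_ends n S x then (- 1) ^ card E else 0) =
      (if S \<union> ?Des \<tau> = allowed_ends n S x then (- 1) ^ card (S \<union> ?Des \<tau>) else (0 :: int))" for \<tau> x
  proof -
    have fin: "finite (allowed_ends n S x)" by (simp add: allowed_ends_def)
    have "allowed_ends n S x \<subseteq> {1..n}" by (auto simp: allowed_ends_def)
    then have "{E \<in> ?EE. ?Des \<tau> \<subseteq> E \<and> E \<subseteq> allowed_ends n S x} =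
        {E. S \<union> ?Des \<tau> \<subseteq> E \<and> E \<subseteq> allowed_ends n S x}" by auto
    then show ?thesis
      unfolding sum.inter_filter[OF finEE, symmetric] by (simp only: sum_alternating_interval[OF fin])
  qed
  have pick: "(\<Sum>x\<in>?X. if A = allowed_ends n S x then c else 0) =
      (if A \<in> allowed_ends n S ` ?X then c else (0 :: int))" for A c
  proof -
    have "(\<Sum>x\<in>?X. if A = allowed_ends n S x then c else 0) =
        (\<Sum>B\<in>allowed_ends n S ` ?X. if A = B then c else 0)"
      by (simp only: sum.reindex[OF inj_on_allowed_ends[OF S]] o_def)
    then show ?thesis using finX by (simp add: sum.delta)
  qed
  have "(\<Sum>E\<in>?EE. (- 1) ^ card E * int (card (descent_roots n k E)) *
      int (card {x \<in> ?X. avoids S x ((\<lambda>e. {1..e}) ` E)})) =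
    (\<Sum>E\<in>?EE. \<Sum>\<tau>\<in>?I. \<Sum>x\<in>?X.
      if ?Des \<tau> \<subseteq> E \<and> E \<subseteq> allowed_ends n S x then (- 1) ^ card E else 0)"
  proof (rule sum.cong[OF refl])
    fix E assume E: "E \<in> ?EE"
    show "(- 1) ^ card E * int (card (descent_roots n k E)) *
        int (card {x \<in> ?X. avoids S x ((\<lambda>e. {1..e}) ` E)}) =
      (\<Sum>\<tau>\<in>?I. \<Sum>x\<in>?X. if ?Des \<tau> \<subseteq> E \<and> E \<subseteq> allowed_ends n S x then (- 1) ^ card E else 0)"
      unfolding card_roots card_points[OF E] mult.assoc sum_product
      unfolding sum_distrib_left
      by (intro sum.cong refl) auto
  qed
  also have "\<dots> = (\<Sum>\<tau>\<in>?I. \<Sum>E\<in>?EE. \<Sum>x\<in>?X.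
      if ?Des \<tau> \<subseteq> E \<and> E \<subseteq> allowed_ends n S x then (- 1) ^ card E else 0)"
    by (rule sum.swap)
  also have "\<dots> = (\<Sum>\<tau>\<in>?I. \<Sum>x\<in>?X. \<Sum>E\<in>?EE.
      if ?Des \<tau> \<subseteq> E \<and> E \<subseteq> allowed_ends n S x then (- 1) ^ card E else 0)"
    by (intro sum.cong[OF refl] sum.swap)
  also have "\<dots> = signed_descent_sum n S k"
    unfolding inner pick signed_descent_sum_def ..
  finally show ?thesis ..
qed

text \<open>The sum over \<open>E\<close> is unfolded into a sum over chains of type
  \<open>E\<close>. Exchanging it with the sums over \<open>x\<close> and \<open>\<sigma>\<close>
  leaves, for each pair, the alternating sum over chains invariant under
  \<open>\<sigma> ^^ k\<close>.\<close>

lemma signed_descent_sum_identity: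
  assumes S: "n \<in> S" "S \<subseteq> {1..n}" and k: "0 < k"
  shows "int (card (prefix_stabilizer n S)) * signed_descent_sum n S k =
    (- 1) ^ card S * (\<Sum>x\<in>block_points S.
      int (card {\<sigma>. \<sigma> permutes {1..n} \<and> \<sigma> ^^ k \<in> block_cyclic_perms n S x}))"
proof -
  let ?X = "block_points S" and ?Ch = "prefix_chains n S"
  let ?P = "{\<sigma>. \<sigma> permutes {1..n}}"
  let ?EE = "{E. S \<subseteq> E \<and> E \<subseteq> {1..n}}"
  define N where "N \<C> = card {\<sigma>. \<sigma> permutes {1..n} \<and> invariant_family (\<sigma> ^^ k) \<C>} *
      card {x \<in> ?X. avoids S x \<C>}" for \<C>
  have finS: "finite S" by (rule finite_subset[OF S(2)]) simp
  have finX: "finite ?X" using finS by (rule finite_block_points)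
  have finEE: "finite ?EE" by (rule finite_subset[of _ "Pow {1..n}"]) auto
  have finP: "finite ?P" by (rule finite_permutations) simp
  have finCh: "finite ?Ch" by (rule finite_prefix_chains)
  have type: "card ` \<C> \<in> ?EE" if \<C>: "\<C> \<in> ?Ch" for \<C>
  proof -
    note D = prefix_chainsD[OF \<C>]
    have "s \<in> card ` \<C>" if "s \<in> S" for s using D(5)[OF that] by (rule rev_image_eqI) simp
    moreover have "card C \<in> {1..n}" if "C \<in> \<C>" for C
      using card_mono[OF _ D(2)[OF that]] D(3,4)[OF that] by (simp add: Suc_le_eq card_gt_0_iff)
    ultimately show ?thesis by blast
  qed
  have "int (card (prefix_stabilizer n S)) * signed_descent_sum n S k =
      (\<Sum>E\<in>?EE. (- 1) ^ card E * (\<Sum>\<C> | \<C> \<in> ?Ch \<and> card ` \<C> = E. int (N \<C>)))"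
    unfolding signed_descent_sum_eq[OF S(2)] sum_distrib_left
  proof (rule sum.cong[OF refl])
    fix E assume E: "E \<in> ?EE"
    then have "(\<Sum>\<C> | \<C> \<in> ?Ch \<and> card ` \<C> = E. N \<C>) =
        card (prefix_stabilizer n S) * card (descent_roots n k E) *
          card {x \<in> ?X. avoids S x ((\<lambda>e. {1..e}) ` E)}"
      unfolding N_def using sum_over_chains_of_type[OF k] by blast
    then have "(\<Sum>\<C> | \<C> \<in> ?Ch \<and> card ` \<C> = E. int (N \<C>)) =
        int (card (prefix_stabilizer n S)) * int (card (descent_roots n k E)) *
          int (card {x \<in> ?X. avoids S x ((\<lambda>e. {1..e}) ` E)})"
      by (simp only: of_nat_sum[symmetric] of_nat_mult)
    then show "int (card (prefix_stabilizer n S)) * ((- 1) ^ card E * int (card (descent_roots n k E)) *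
          int (card {x \<in> ?X. avoids S x ((\<lambda>e. {1..e}) ` E)})) =
        (\<Sum>\<C> | \<C> \<in> ?Ch \<and> card ` \<C> = E. (- 1) ^ card E * int (N \<C>))"
      unfolding sum_distrib_left[symmetric] by (simp only: ac_simps)
  qed
  \<comment> \<open>Members of a chain have distinct sizes, so a chain has as many members as its
    type has elements.\<close>
  also have "\<dots> = (\<Sum>E\<in>?EE. \<Sum>\<C> | \<C> \<in> ?Ch \<and> card ` \<C> = E. (- 1) ^ card \<C> * int (N \<C>))"
    unfolding sum_distrib_left
    by (intro sum.cong refl) (auto simp: card_image inj_on_card_prefix_chain)
  also have "\<dots> = (\<Sum>\<C>\<in>?Ch. (- 1) ^ card \<C> * int (N \<C>))"
    by (rule sum.group[OF finCh finEE]) (use type in blast)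
  also have "\<dots> = (\<Sum>\<C>\<in>?Ch. \<Sum>x\<in>?X. \<Sum>\<sigma>\<in>?P.
      if avoids S x \<C> \<and> invariant_family (\<sigma> ^^ k) \<C> then (- 1) ^ card \<C> else 0)"
  proof (rule sum.cong[OF refl])
    fix \<C>
    have "int (card {x \<in> ?X. avoids S x \<C>}) = (\<Sum>x\<in>?X. if avoids S x \<C> then 1 else 0)"
      by (simp add: finX flip: sum.inter_filter)
    moreover have "int (card {\<sigma>. \<sigma> permutes {1..n} \<and> invariant_family (\<sigma> ^^ k) \<C>}) =
        (\<Sum>\<sigma>\<in>?P. if invariant_family (\<sigma> ^^ k) \<C> then 1 else 0)"
      using finP by (simp flip: sum.inter_filter)
    moreover have "int (N \<C>) = int (card {x \<in> ?X. avoids S x \<C>}) *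
        int (card {\<sigma>. \<sigma> permutes {1..n} \<and> invariant_family (\<sigma> ^^ k) \<C>})"
      by (simp add: N_def)
    ultimately have "int (N \<C>) = (\<Sum>x\<in>?X. \<Sum>\<sigma>\<in>?P.
        (if avoids S x \<C> then 1 else 0) * (if invariant_family (\<sigma> ^^ k) \<C> then 1 else 0))"
      by (simp only: sum_product)
    then show "(- 1) ^ card \<C> * int (N \<C>) = (\<Sum>x\<in>?X. \<Sum>\<sigma>\<in>?P.
        if avoids S x \<C> \<and> invariant_family (\<sigma> ^^ k) \<C> then (- 1) ^ card \<C> else 0)"
      by (simp only: sum_distrib_left) (intro sum.cong refl, auto)
  qed
  also have "\<dots> = (\<Sum>x\<in>?X. \<Sum>\<sigma>\<in>?P. \<Sum>\<C>\<in>?Ch.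
      if avoids S x \<C> \<and> invariant_family (\<sigma> ^^ k) \<C> then (- 1) ^ card \<C> else 0)"
    by (subst sum.swap, rule sum.cong[OF refl], rule sum.swap)
  also have "\<dots> = (\<Sum>x\<in>?X. \<Sum>\<sigma>\<in>?P.
      if \<sigma> ^^ k \<in> block_cyclic_perms n S x then (- 1) ^ card S else 0)"
  proof (intro sum.cong refl)
    fix x \<sigma> assume x: "x \<in> ?X" and "\<sigma> \<in> ?P"
    then have "\<sigma> ^^ k permutes {1..n}" by (simp add: permutes_funpow)
    from alternating_sum_invariant_chains[OF S x this]
    show "(\<Sum>\<C>\<in>?Ch. if avoids S x \<C> \<and> invariant_family (\<sigma> ^^ k) \<C> then (- 1) ^ card \<C> else 0) =
        (if \<sigma> ^^ k \<in> block_cyclic_perms n S x then (- 1) ^ card S else (0 :: int))"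
      unfolding sum.inter_filter[OF finCh, symmetric] block_cyclic_perms_def by simp
  qed
  also have "\<dots> = (\<Sum>x\<in>?X. (- 1) ^ card S *
      int (card {\<sigma>. \<sigma> permutes {1..n} \<and> \<sigma> ^^ k \<in> block_cyclic_perms n S x}))"
    by (intro sum.cong refl) (use finP in \<open>simp flip: sum.inter_filter\<close>)
  finally show ?thesis by (simp only: sum_distrib_left)
qed

section \<open>Conjugacy and cycle type\<close>

text \<open>The size of the orbit is the least period of \<open>a\<close>, so exponents matter only
  modulo that size.\<close>

lemma funpow_eq_iff_mod_card_orbit:
  assumes "permutation p"
  shows "(p ^^ i) a = (p ^^ j) a \<longleftrightarrow> i mod card (orbit p a) = j mod card (orbit p a)"
proof -
  let ?L = "least_power p a"
  note L = least_power_of_permutation[OF assms, of a]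
  have inj: "inj (p ^^ m)" for m
    using permutation_funpow[OF assms] permutation_bijective bij_is_inj by blast
  have dvd: "?L dvd j - i" if "i \<le> j" "(p ^^ i) a = (p ^^ j) a" for i j
  proof -
    have "(p ^^ i) a = (p ^^ i) ((p ^^ (j - i)) a)"
      using that funpow_add[of i "j - i" p] by simp
    then have "(p ^^ (j - i)) a = a" using injD[OF inj] by metis
    then show ?thesis by (rule least_power_minimal)
  qed
  have iff: "(p ^^ i) a = (p ^^ j) a \<longleftrightarrow> i mod ?L = j mod ?L" for i j
  proof
    show "i mod ?L = j mod ?L" if eq: "(p ^^ i) a = (p ^^ j) a"
    proof (cases "i \<le> j")
      case True
      then show ?thesis using dvd[OF True eq] mod_eq_dvd_iff_nat[of i j ?L] by simp
    next
      case False
      then have "j \<le> i" by simp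
      then show ?thesis using dvd[OF _ eq[symmetric]] mod_eq_dvd_iff_nat[of j i ?L] by simp
    qed
    show "(p ^^ i) a = (p ^^ j) a" if "i mod ?L = j mod ?L"
      using funpow_mod_eq[OF L(1)] that by metis
  qed
  have "orbit p a = (\<lambda>m. (p ^^ m) a) ` {..<?L}"
    using orbit_altdef_bounded[OF L] by auto
  moreover have "inj_on (\<lambda>m. (p ^^ m) a) {..<?L}" by (rule inj_onI) (simp add: iff)
  ultimately have "card (orbit p a) = ?L" by (simp add: card_image)
  then show ?thesis using iff by simp
qed

lemma image_mset_eq_mset_obtain:
  assumes "image_mset f M = mset c"
  obtains xs where "mset xs = M" "map f xs = c"
  using assms
proof (induction c arbitrary: M thesis)
  case Nil
  then show ?case by (metis image_mset_is_empty_iff list.simps(8) mset.simps(1))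
next
  case (Cons b c)
  obtain M1 a where M1: "M = add_mset a M1" "f a = b" "image_mset f M1 = mset c"
    using msed_map_invR[of f M b "mset c"] Cons.prems(2) by auto
  obtain xs where "mset xs = M1" "map f xs = c" using Cons.IH[OF _ M1(3)] by blast
  then show ?case using Cons.prems(1)[of "a # xs"] M1 by simp
qed

lemma orbit_eq_of_mem:
  assumes "permutation p" "y \<in> orbit p x"
  shows "orbit p y = orbit p x"
proof
  have "x \<in> orbit p y" by (rule orbit_swap[OF permutation_self_in_orbit[OF assms(1)] assms(2)])
  then show "orbit p x \<subseteq> orbit p y" using orbit_trans by fast
  show "orbit p y \<subseteq> orbit p x" using orbit_trans[OF _ assms(2)] by blast
qed

text \<open>The cycles are numbered so that their lengths follow the list \<open>c\<close>. Two
  permutations of the same cycle type then have their cycles matched by index.\<close>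

lemma orbit_representatives:
  assumes "\<pi> permutes {1..n}" "cycle_type n \<pi> = mset c"
  obtains a where "\<And>i. i < length c \<Longrightarrow> a i \<in> {1..n} \<and> card (orbit \<pi> (a i)) = c ! i"
    "\<And>y. y \<in> {1..n} \<Longrightarrow> \<exists>i<length c. y \<in> orbit \<pi> (a i)"
    "\<And>i j y. i < length c \<Longrightarrow> j < length c \<Longrightarrow> y \<in> orbit \<pi> (a i) \<Longrightarrow> y \<in> orbit \<pi> (a j) \<Longrightarrow> i = j"
proof -
  have perm: "permutation \<pi>" using assms(1) by (auto simp: permutation_permutes)
  let ?O = "orbit \<pi> ` {1..n}"
  obtain xs where xs: "mset xs = mset_set ?O" "map card xs = c"
    by (rule image_mset_eq_mset_obtain[OF assms(2)[unfolded cycle_type_def]])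
  have len: "length xs = length c" using xs(2) by auto
  have set: "set xs = ?O" using arg_cong[OF xs(1), of set_mset] by simp
  have "card (set xs) = length xs"
    unfolding set using arg_cong[OF xs(1), of size] by simp
  then have dist: "distinct xs" by (rule card_distinct)
  have "\<forall>i\<in>{..<length c}. \<exists>y. y \<in> {1..n} \<and> xs ! i = orbit \<pi> y"
  proof
    fix i assume "i \<in> {..<length c}"
    then have "xs ! i \<in> ?O" unfolding set[symmetric] using len by simp
    then show "\<exists>y. y \<in> {1..n} \<and> xs ! i = orbit \<pi> y" by blast
  qed
  from bchoice[OF this] obtain a where "\<forall>i\<in>{..<length c}. a i \<in> {1..n} \<and> xs ! i = orbit \<pi> (a i)" ..
  then have a: "a i \<in> {1..n}" "xs ! i = orbit \<pi> (a i)" if "i < length c" for i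
    using that by simp_all
  show ?thesis
  proof (rule that)
    fix i assume i: "i < length c"
    then have "c ! i = card (xs ! i)" unfolding xs(2)[symmetric] by simp
    with a[OF i] show "a i \<in> {1..n} \<and> card (orbit \<pi> (a i)) = c ! i" by simp
  next
    fix y assume "y \<in> {1..n}"
    then have "orbit \<pi> y \<in> set xs" unfolding set by blast
    then obtain i where i: "i < length c" "orbit \<pi> y = xs ! i"
      unfolding len[symmetric] in_set_conv_nth by auto
    then have "y \<in> orbit \<pi> (a i)" using permutation_self_in_orbit[OF perm, of y] a(2)[OF i(1)] by simp
    with i(1) show "\<exists>i<length c. y \<in> orbit \<pi> (a i)" by blast
  next
    fix i j y assume ij: "i < length c" "j < length c" and y: "y \<in> orbit \<pi> (a i)" "y \<in> orbit \<pi> (a j)"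
    have "xs ! i = xs ! j" unfolding a(2)[OF ij(1)] a(2)[OF ij(2)]
      using orbit_eq_of_mem[OF perm y(1)] orbit_eq_of_mem[OF perm y(2)] by simp
    then show "i = j" using nth_eq_iff_index_eq[OF dist] ij len by simp
  qed
qed

text \<open>The conjugator sends \<open>(\<pi> ^^ j) (a i)\<close> to
  \<open>(\<rho> ^^ j) (b i)\<close>, where \<open>a i\<close> and \<open>b i\<close> represent the
  \<open>i\<close>-th cycles.\<close>

lemma ex_conjugating_permutation:
  assumes \<pi>: "\<pi> permutes {1..n}" and \<rho>: "\<rho> permutes {1..n}" and "cycle_type n \<pi> = cycle_type n \<rho>"
  obtains g where "g permutes {1..n}" "\<And>y. g (\<pi> y) = \<rho> (g y)"
proof -
  obtain c where c: "cycle_type n \<pi> = mset c" using ex_mset[of "cycle_type n \<pi>"] by metis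
  then have c': "cycle_type n \<rho> = mset c" using assms(3) by simp
  have perm: "permutation \<pi>" "permutation \<rho>" using \<pi> \<rho> by (auto simp: permutation_permutes)
  obtain a where a: "\<And>i. i < length c \<Longrightarrow> a i \<in> {1..n} \<and> card (orbit \<pi> (a i)) = c ! i"
    "\<And>y. y \<in> {1..n} \<Longrightarrow> \<exists>i<length c. y \<in> orbit \<pi> (a i)"
    "\<And>i j y. i < length c \<Longrightarrow> j < length c \<Longrightarrow> y \<in> orbit \<pi> (a i) \<Longrightarrow> y \<in> orbit \<pi> (a j) \<Longrightarrow> i = j"
    by (rule orbit_representatives[OF \<pi> c]) (erule that; assumption)
  obtain b where b: "\<And>i. i < length c \<Longrightarrow> b i \<in> {1..n} \<and> card (orbit \<rho> (b i)) = c ! i"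
    "\<And>y. y \<in> {1..n} \<Longrightarrow> \<exists>i<length c. y \<in> orbit \<rho> (b i)"
    "\<And>i j y. i < length c \<Longrightarrow> j < length c \<Longrightarrow> y \<in> orbit \<rho> (b i) \<Longrightarrow> y \<in> orbit \<rho> (b j) \<Longrightarrow> i = j"
    by (rule orbit_representatives[OF \<rho> c']) (erule that; assumption)
  have in_orbit: "(p ^^ j) z \<in> orbit p z" if "permutation p" for p :: "nat \<Rightarrow> nat" and j z
    by (rule funpow_in_orbit[OF permutation_self_in_orbit[OF that]])
  have coords: "\<exists>i j. i < length c \<and> y = (\<pi> ^^ j) (a i)" if "y \<in> {1..n}" for y
    using a(2)[OF that] unfolding orbit_altdef_permutation[OF perm(1)] by blast
  define g where "g y = (if y \<in> {1..n}
    then (case (SOME (i, j). i < length c \<and> y = (\<pi> ^^ j) (a i)) of (i, j) \<Rightarrow> (\<rho> ^^ j) (b i)) else y)" for y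
  \<comment> \<open>The value does not depend on the coordinates selected by \<open>SOME\<close>:
    \<open>i\<close> is unique, and \<open>j\<close> is unique modulo the common length of the two
    \<open>i\<close>-th cycles.\<close>
  have g: "g ((\<pi> ^^ j) (a i)) = (\<rho> ^^ j) (b i)" if i: "i < length c" for i j
  proof -
    let ?y = "(\<pi> ^^ j) (a i)"
    let ?Q = "\<lambda>(i, j). i < length c \<and> ?y = (\<pi> ^^ j) (a i)"
    obtain i' j' where ij': "(SOME ij. ?Q ij) = (i', j')" by force
    have "?Q (SOME ij. ?Q ij)" by (rule someI[of ?Q "(i, j)"]) (use i in simp)
    then have i': "i' < length c" and y: "?y = (\<pi> ^^ j') (a i')" unfolding ij' by auto
    have "i' = i" using a(3)[OF i' i] in_orbit[OF perm(1), of j' "a i'"] in_orbit[OF perm(1), of j "a i"] y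
      by simp
    then have "(\<rho> ^^ j') (b i') = (\<rho> ^^ j) (b i)"
      using y a(1)[OF i] b(1)[OF i] funpow_eq_iff_mod_card_orbit[OF perm(1)]
        funpow_eq_iff_mod_card_orbit[OF perm(2)] by simp
    moreover have "?y \<in> {1..n}"
      using a(1)[OF i] permutes_funpow[OF \<pi>] by (simp only: permutes_in_image)
    then have "g ?y = (\<rho> ^^ j') (b i')" unfolding g_def using ij' by simp
    ultimately show ?thesis by simp
  qed
  have "inj_on g {1..n}"
  proof (rule inj_onI)
    fix y z assume yz: "y \<in> {1..n}" "z \<in> {1..n}" "g y = g z"
    obtain i j where ij: "i < length c" "y = (\<pi> ^^ j) (a i)" using coords[OF yz(1)] by blast
    obtain i' j' where ij': "i' < length c" "z = (\<pi> ^^ j') (a i')" using coords[OF yz(2)] by blast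
    have eq: "(\<rho> ^^ j) (b i) = (\<rho> ^^ j') (b i')" using yz(3) g[OF ij(1)] g[OF ij'(1)] ij(2) ij'(2) by simp
    then have "i = i'" using b(3)[OF ij(1) ij'(1)] in_orbit[OF perm(2), of j "b i"] in_orbit[OF perm(2), of j' "b i'"]
      by simp
    then show "y = z"
      using eq ij ij' a(1)[OF ij(1)] b(1)[OF ij(1)] funpow_eq_iff_mod_card_orbit[OF perm(1)]
        funpow_eq_iff_mod_card_orbit[OF perm(2)] by simp
  qed
  moreover have g_in: "g y \<in> {1..n}" if y: "y \<in> {1..n}" for y
  proof -
    obtain i j where ij: "i < length c" "y = (\<pi> ^^ j) (a i)" using coords[OF y] by blast
    show ?thesis unfolding ij(2) g[OF ij(1)]
      using b(1)[OF ij(1)] permutes_funpow[OF \<rho>] by (simp only: permutes_in_image)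
  qed
  then have "g ` {1..n} \<subseteq> {1..n}" by (rule image_subsetI)
  ultimately have "bij_betw g {1..n} {1..n}" by (simp add: bij_betw_def endo_inj_surj)
  then have gp: "g permutes {1..n}" by (rule bij_imp_permutes) (auto simp: g_def)
  have "g (\<pi> y) = \<rho> (g y)" for y
  proof (cases "y \<in> {1..n}")
    case True
    obtain i j where ij: "i < length c" "y = (\<pi> ^^ j) (a i)" using coords[OF True] by blast
    then show ?thesis using g[OF ij(1), of j] g[OF ij(1), of "Suc j"] by simp
  next
    case False
    then show ?thesis using \<pi> \<rho> gp by (simp add: permutes_not_in)
  qed
  with gp show ?thesis by (rule that)
qed

lemma card_roots_cong_cycle_type:
  assumes \<pi>: "\<pi> permutes {1..n}" and \<rho>: "\<rho> permutes {1..n}" and "cycle_type n \<pi> = cycle_type n \<rho>"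
  shows "card {\<sigma>. \<sigma> permutes {1..n} \<and> \<sigma> ^^ k = \<rho>} = card {\<sigma>. \<sigma> permutes {1..n} \<and> \<sigma> ^^ k = \<pi>}"
proof -
  obtain g where g: "g permutes {1..n}" and comm: "\<And>y. g (\<pi> y) = \<rho> (g y)"
    using ex_conjugating_permutation[OF assms] by blast
  have bij: "bij g" using g by (rule permutes_bij)
  have inv: "inv g permutes {1..n}" using g by (rule permutes_inv)
  let ?A = "{\<sigma>. \<sigma> permutes {1..n} \<and> \<sigma> ^^ k = \<rho>}" and ?B = "{\<sigma>. \<sigma> permutes {1..n} \<and> \<sigma> ^^ k = \<pi>}"
  have \<pi>_eq: "\<pi> = inv g \<circ> \<rho> \<circ> g"
    using comm g by (auto simp: fun_eq_iff permutes_inverses simp flip: comm)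
  have cancel: "g \<circ> (inv g \<circ> f \<circ> g) \<circ> inv g = f" "inv g \<circ> (g \<circ> f \<circ> inv g) \<circ> g = f" for f
    using g by (auto simp: fun_eq_iff permutes_inverses)
  have "bij_betw (\<lambda>\<sigma>. inv g \<circ> \<sigma> \<circ> g) ?A ?B"
  proof (rule bij_betw_byWitness[where f' = "\<lambda>\<sigma>. g \<circ> \<sigma> \<circ> inv g"])
    show "(\<lambda>\<sigma>. inv g \<circ> \<sigma> \<circ> g) ` ?A \<subseteq> ?B"
      using g inv conjugate_funpow[OF bij] \<pi>_eq by (auto simp: permutes_compose)
    show "(\<lambda>\<sigma>. g \<circ> \<sigma> \<circ> inv g) ` ?B \<subseteq> ?A"
    proof (rule image_subsetI)
      fix \<sigma> assume "\<sigma> \<in> ?B"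
      then have \<sigma>: "\<sigma> permutes {1..n}" "\<sigma> ^^ k = \<pi>" by auto
      have "(g \<circ> \<sigma> \<circ> inv g) ^^ k = g \<circ> \<pi> \<circ> inv g"
        using conjugate_funpow[OF bij_imp_bij_inv[OF bij], where f = \<sigma> and j = k] \<sigma>(2) by (simp only: inv_inv_eq[OF bij])
      also have "\<dots> = \<rho>" unfolding \<pi>_eq by (rule cancel(1))
      finally show "g \<circ> \<sigma> \<circ> inv g \<in> ?A" using \<sigma>(1) g inv by (simp add: permutes_compose)
    qed
  qed (use cancel in simp_all)
  then show ?thesis by (rule bij_betw_same_card)
qed

section \<open>Block structure of a partition\<close>

text \<open>Equality with a set of allowed ends can be tested block by block: block ends belong to
  both sets, and the points can be chosen independently in the blocks.\<close>

lemma signed_descent_support_iff: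
  assumes S: "n \<in> S" "S \<subseteq> {1..n}"
  shows "S \<union> descent_set n \<tau> \<in> allowed_ends n S ` block_points S \<longleftrightarrow>
    (\<forall>s\<in>S. \<exists>y\<in>block S s. \<forall>j\<in>block S s. j < s \<longrightarrow> (j < y \<longleftrightarrow> \<tau> j > \<tau> (Suc j)))"
    (is "_ \<longleftrightarrow> ?R")
proof -
  have fin: "finite S" by (rule finite_subset[OF S(2)]) simp
  have sn: "s \<le> n" if "s \<in> S" for s using subsetD[OF S(2) that] by simp
  have mem: "j \<in> S \<union> descent_set n \<tau> \<longleftrightarrow> \<tau> j > \<tau> (Suc j)"
    if "s \<in> S" "j \<in> block S s" "j < s" for s j
    using that sn[OF that(1)] by (auto simp: block_def descent_set_def)
  show ?thesis
  proof
    assume "S \<union> descent_set n \<tau> \<in> allowed_ends n S ` block_points S"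
    then obtain x where x: "x \<in> block_points S" and eq: "S \<union> descent_set n \<tau> = allowed_ends n S x" by blast
    have "j < x s \<longleftrightarrow> \<tau> j > \<tau> (Suc j)" if "s \<in> S" "j \<in> block S s" "j < s" for s j
      using mem[OF that] block_point_allowed_iff[OF x that(1) sn[OF that(1)] that(2,3)] eq by simp
    then show ?R using block_point_bounds(1)[OF x] by blast
  next
    assume ?R
    from bchoice[OF this[unfolded Bex_def]] obtain y where y: "\<And>s. s \<in> S \<Longrightarrow> y s \<in> block S s"
      "\<And>s j. s \<in> S \<Longrightarrow> j \<in> block S s \<Longrightarrow> j < s \<Longrightarrow> (j < y s \<longleftrightarrow> \<tau> j > \<tau> (Suc j))" by blast
    define x where "x = restrict y S"
    have x: "x \<in> block_points S" using y(1) by (auto simp: x_def block_points_def)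
    have xs: "x s = y s" if "s \<in> S" for s using that by (simp add: x_def)
    have "S \<union> descent_set n \<tau> = allowed_ends n S x"
    proof (rule set_eqI)
      fix j
      show "j \<in> S \<union> descent_set n \<tau> \<longleftrightarrow> j \<in> allowed_ends n S x"
      proof (cases "j \<in> {1..n}")
        case True
        then obtain s where s: "s \<in> S" "j \<in> block S s" by (rule block_of[OF fin S(1)])
        show ?thesis
        proof (cases "j < s")
          case True
          show ?thesis
            using mem[OF s True] y(2)[OF s True] xs[OF s(1)]
              block_point_allowed_iff[OF x s(1) sn[OF s(1)] s(2) True] by simp
        next
          case False
          then have "j = s" using s(2) by (simp add: block_def)
          then show ?thesis using s(1) subset_allowed_ends[OF S(2) x] by blast
        qed
      next
        case False
        then show ?thesis using S(2) by (auto simp: allowed_ends_def descent_set_def)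
      qed
    qed
    then show "S \<union> descent_set n \<tau> \<in> allowed_ends n S ` block_points S" using x by blast
  qed
qed

lemma partial_sum_0 [simp]: "partial_sum \<mu> 0 = 0"
  by (simp add: partial_sum_def)

lemma partial_sum_Suc: "i < length \<mu> \<Longrightarrow> partial_sum \<mu> (Suc i) = partial_sum \<mu> i + \<mu> ! i"
  by (simp add: partial_sum_def take_Suc_conv_app_nth)

lemma partial_sum_strict_mono:
  assumes "\<forall>m\<in>set \<mu>. m > 0" "i < j" "j \<le> length \<mu>"
  shows "partial_sum \<mu> i < partial_sum \<mu> j"
  using assms(2,3)
proof (induction j)
  case (Suc j)
  have "0 < \<mu> ! j" using assms(1) Suc.prems by simp
  then have "partial_sum \<mu> j < partial_sum \<mu> (Suc j)" using Suc.prems partial_sum_Suc by simp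
  then show ?case using Suc by (cases "i = j") auto
qed simp

lemma partial_sums_eq: "partial_sums \<mu> = (\<lambda>i. partial_sum \<mu> (Suc i)) ` {..<length \<mu>}"
proof -
  have "{1..length \<mu>} = Suc ` {..<length \<mu>}" by (simp only: image_Suc_lessThan)
  then show ?thesis unfolding partial_sums_def by (simp only: image_image)
qed

lemma block_partial_sums:
  assumes pos: "\<forall>m\<in>set \<mu>. m > 0" and i: "i < length \<mu>"
  shows "block (partial_sums \<mu>) (partial_sum \<mu> (Suc i)) = {partial_sum \<mu> i <.. partial_sum \<mu> (Suc i)}"
proof -
  have lower: "(\<forall>s\<in>partial_sums \<mu>. s < partial_sum \<mu> (Suc i) \<longrightarrow> s < y) \<longleftrightarrow> partial_sum \<mu> i < y" if "0 < y" for y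
  proof
    assume *: "\<forall>s\<in>partial_sums \<mu>. s < partial_sum \<mu> (Suc i) \<longrightarrow> s < y"
    show "partial_sum \<mu> i < y"
    proof (cases i)
      case 0
      \<comment> \<open>The first block has no preceding element of \<open>S\<close>; the lower
        bound is \<open>partial_sum \<mu> 0 = 0\<close>, supplied by the assumption
        \<open>0 < y\<close>.\<close>
      then show ?thesis using that by simp
    next
      case (Suc i')
      then have "partial_sum \<mu> i \<in> partial_sums \<mu>" using i by (auto simp: partial_sums_eq)
      with * show ?thesis using partial_sum_strict_mono[OF pos, of i "Suc i"] i by simp
    qed
  next
    assume y: "partial_sum \<mu> i < y"
    show "\<forall>s\<in>partial_sums \<mu>. s < partial_sum \<mu> (Suc i) \<longrightarrow> s < y"
    proof (intro ballI impI)
      fix s assume "s \<in> partial_sums \<mu>" and less: "s < partial_sum \<mu> (Suc i)"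
      then obtain j where j: "j \<le> length \<mu>" "s = partial_sum \<mu> j" by (auto simp: partial_sums_def)
      have "j \<le> i"
      proof (rule ccontr)
        assume "\<not> j \<le> i"
        then have "Suc i = j \<or> Suc i < j" by auto
        then show False using less j partial_sum_strict_mono[OF pos, of "Suc i" j] by auto
      qed
      then have "s \<le> partial_sum \<mu> i"
        using partial_sum_strict_mono[OF pos, of j i] i j(2) by (cases "j = i") auto
      with y show "s < y" by simp
    qed
  qed
  show ?thesis
  proof (rule set_eqI)
    fix y
    show "y \<in> block (partial_sums \<mu>) (partial_sum \<mu> (Suc i)) \<longleftrightarrow>
        y \<in> {partial_sum \<mu> i <.. partial_sum \<mu> (Suc i)}"
      using lower[of y] by (cases "0 < y") (auto simp: block_def)
  qed
qed

text \<open>The two forms correspond under \<open>y = p + l\<close>, the position of the minimum. As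
  adjacent values differ, a position that is not a descent is an ascent.\<close>

lemma unimodal_on_block_iff:
  fixes p m :: nat and \<tau> :: "nat \<Rightarrow> nat"
  assumes "\<And>j. \<tau> j \<noteq> \<tau> (Suc j)"
  shows "(\<exists>l\<in>{1..m}. (\<forall>j\<in>{1..<l}. \<tau> (p + j) > \<tau> (p + j + 1)) \<and> (\<forall>j\<in>{l..<m}. \<tau> (p + j) < \<tau> (p + j + 1))) \<longleftrightarrow>
    (\<exists>y\<in>{p<..p + m}. \<forall>j\<in>{p<..p + m}. j < p + m \<longrightarrow> (j < y \<longleftrightarrow> \<tau> j > \<tau> (Suc j)))"
proof
  assume "\<exists>l\<in>{1..m}. (\<forall>j\<in>{1..<l}. \<tau> (p + j) > \<tau> (p + j + 1)) \<and> (\<forall>j\<in>{l..<m}. \<tau> (p + j) < \<tau> (p + j + 1))"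
  then obtain l where l: "l \<in> {1..m}" "\<And>j. j \<in> {1..<l} \<Longrightarrow> \<tau> (p + j) > \<tau> (p + j + 1)"
    "\<And>j. j \<in> {l..<m} \<Longrightarrow> \<tau> (p + j) < \<tau> (p + j + 1)" by blast
  have "j < p + l \<longleftrightarrow> \<tau> j > \<tau> (Suc j)" if "j \<in> {p<..p + m}" "j < p + m" for j
  proof -
    define i where "i = j - p"
    have "j = p + i" "1 \<le> i" "i < m" using that by (auto simp: i_def)
    then show ?thesis using l(2)[of i] l(3)[of i] by (cases "i < l") auto
  qed
  moreover have "p + l \<in> {p<..p + m}" using l(1) by simp
  ultimately show "\<exists>y\<in>{p<..p + m}. \<forall>j\<in>{p<..p + m}. j < p + m \<longrightarrow> (j < y \<longleftrightarrow> \<tau> j > \<tau> (Suc j))" by blast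
next
  assume "\<exists>y\<in>{p<..p + m}. \<forall>j\<in>{p<..p + m}. j < p + m \<longrightarrow> (j < y \<longleftrightarrow> \<tau> j > \<tau> (Suc j))"
  then obtain y where y: "y \<in> {p<..p + m}"
    "\<And>j. j \<in> {p<..p + m} \<Longrightarrow> j < p + m \<Longrightarrow> (j < y \<longleftrightarrow> \<tau> j > \<tau> (Suc j))" by blast
  show "\<exists>l\<in>{1..m}. (\<forall>j\<in>{1..<l}. \<tau> (p + j) > \<tau> (p + j + 1)) \<and> (\<forall>j\<in>{l..<m}. \<tau> (p + j) < \<tau> (p + j + 1))"
  proof (intro bexI conjI ballI)
    show "y - p \<in> {1..m}" using y(1) by auto
    show "\<tau> (p + j) > \<tau> (p + j + 1)" if "j \<in> {1..<y - p}" for j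
    proof -
      have less: "p + j < y" using that by auto
      then show ?thesis using y(2)[of "p + j"] that y(1) by auto
    qed
    show "\<tau> (p + j) < \<tau> (p + j + 1)" if "j \<in> {y - p..<m}" for j
    proof -
      have "y \<le> p + j" "0 < j" using that y(1) by auto
      then show ?thesis using y(2)[of "p + j"] that assms[of "p + j"] by auto
    qed
  qed
qed

lemma unimodal_perms_iff:
  assumes pos: "\<forall>m\<in>set \<mu>. m > 0" and S: "n \<in> partial_sums \<mu>" "partial_sums \<mu> \<subseteq> {1..n}"
    and \<tau>: "\<tau> permutes {1..n}"
  shows "\<tau> \<in> unimodal_perms n \<mu> \<longleftrightarrow>
    partial_sums \<mu> \<union> descent_set n \<tau> \<in> allowed_ends n (partial_sums \<mu>) ` block_points (partial_sums \<mu>)"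
proof -
  have neq: "\<tau> j \<noteq> \<tau> (Suc j)" for j using injD[OF permutes_inj[OF \<tau>], of j "Suc j"] by auto
  let ?P = "\<lambda>B s. \<exists>y\<in>B. \<forall>j\<in>B. j < s \<longrightarrow> (j < y \<longleftrightarrow> \<tau> j > \<tau> (Suc j))"
  let ?V = "\<lambda>p m. \<exists>l\<in>{1..m}. (\<forall>j\<in>{1..<l}. \<tau> (p + j) > \<tau> (p + j + 1)) \<and>
       (\<forall>j\<in>{l..<m}. \<tau> (p + j) < \<tau> (p + j + 1))"
  have "?V (partial_sum \<mu> i) (\<mu> ! i) \<longleftrightarrow>
      ?P (block (partial_sums \<mu>) (partial_sum \<mu> (Suc i))) (partial_sum \<mu> (Suc i))"
    if "i < length \<mu>" for i
    unfolding block_partial_sums[OF pos that] unfolding partial_sum_Suc[OF that]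
    by (rule unimodal_on_block_iff[where \<tau> = \<tau>, OF neq])
  moreover have "\<tau> \<in> unimodal_perms n \<mu> \<longleftrightarrow> (\<forall>i<length \<mu>. ?V (partial_sum \<mu> i) (\<mu> ! i))"
    using \<tau> by (simp add: unimodal_perms_def symm_perms_def)
  ultimately have "\<tau> \<in> unimodal_perms n \<mu> \<longleftrightarrow> (\<forall>i<length \<mu>.
      ?P (block (partial_sums \<mu>) (partial_sum \<mu> (Suc i))) (partial_sum \<mu> (Suc i)))"
    by blast
  also have "\<dots> \<longleftrightarrow> (\<forall>s\<in>partial_sums \<mu>. ?P (block (partial_sums \<mu>) s) s)"
    unfolding partial_sums_eq ball_simps(9) by (simp only: Ball_def lessThan_iff)
  finally show ?thesis unfolding signed_descent_support_iff[OF S] .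
qed

lemma signed_descent_sum_partial_sums:
  assumes pos: "\<forall>m\<in>set \<mu>. m > 0" and S: "n \<in> partial_sums \<mu>" "partial_sums \<mu> \<subseteq> {1..n}"
  shows "signed_descent_sum n (partial_sums \<mu>) k = (- 1) ^ card (partial_sums \<mu>) *
    (\<Sum>\<tau>\<in>identity_roots n k \<inter> unimodal_perms n \<mu>. (- 1) ^ card (descent_set n \<tau> - partial_sums \<mu>))"
proof -
  have "card (partial_sums \<mu> \<union> descent_set n \<tau>) =
      card (partial_sums \<mu>) + card (descent_set n \<tau> - partial_sums \<mu>)" for \<tau>
  proof -
    have "finite (partial_sums \<mu>)" by (simp add: partial_sums_def)
    moreover have "finite (descent_set n \<tau>)" by (simp add: descent_set_def)
    ultimately show ?thesis using card_Un_disjoint[of "partial_sums \<mu>" "descent_set n \<tau> - partial_sums \<mu>"]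
      by simp
  qed
  then have "signed_descent_sum n (partial_sums \<mu>) k = (\<Sum>\<tau>\<in>identity_roots n k.
      if \<tau> \<in> unimodal_perms n \<mu>
      then (- 1) ^ card (partial_sums \<mu>) * (- 1) ^ card (descent_set n \<tau> - partial_sums \<mu>) else 0)"
    unfolding signed_descent_sum_def
    by (intro sum.cong refl) (simp add: power_add unimodal_perms_iff[OF pos S] identity_roots_def symm_perms_def)
  also have "\<dots> = (\<Sum>\<tau>\<in>identity_roots n k \<inter> unimodal_perms n \<mu>.
      (- 1) ^ card (partial_sums \<mu>) * (- 1) ^ card (descent_set n \<tau> - partial_sums \<mu>))"
    by (rule sum.inter_restrict[OF finite_identity_roots, symmetric])
  finally show ?thesis by (simp only: sum_distrib_left)
qed

text \<open>The cycles are exactly the blocks, since every point lies in the block of some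
  \<open>s\<close> and that block is the orbit of \<open>x s\<close>; the block lengths are the
  parts of \<open>\<mu>\<close>.\<close>

lemma cycle_type_block_cyclic:
  assumes pos: "\<forall>m\<in>set \<mu>. m > 0" and S: "n \<in> partial_sums \<mu>" "partial_sums \<mu> \<subseteq> {1..n}"
    and x: "x \<in> block_points (partial_sums \<mu>)"
    and \<rho>: "\<rho> \<in> block_cyclic_perms n (partial_sums \<mu>) x"
  shows "cycle_type n \<rho> = mset \<mu>"
proof -
  let ?S = "partial_sums \<mu>"
  have \<rho>p: "\<rho> permutes {1..n}" and orb: "\<And>s. s \<in> ?S \<Longrightarrow> orbit \<rho> (x s) = block ?S s"
    using \<rho> by (auto simp: block_cyclic_perms_def prefix_stabilizer_def)
  have perm: "permutation \<rho>" using \<rho>p by (auto simp: permutation_permutes)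
  have fin: "finite ?S" by (rule finite_subset[OF S(2)]) simp
  have "orbit \<rho> ` {1..n} = block ?S ` ?S"
  proof
    show "orbit \<rho> ` {1..n} \<subseteq> block ?S ` ?S"
    proof (rule image_subsetI)
      fix y assume "y \<in> {1..n}"
      then obtain s where s: "s \<in> ?S" "y \<in> block ?S s" by (rule block_of[OF fin S(1)])
      then have "orbit \<rho> y = block ?S s" using orbit_eq_of_mem[OF perm, of y "x s"] orb by simp
      with s(1) show "orbit \<rho> y \<in> block ?S ` ?S" by blast
    qed
    show "block ?S ` ?S \<subseteq> orbit \<rho> ` {1..n}"
    proof (rule image_subsetI)
      fix s assume s: "s \<in> ?S"
      have "x s \<in> {1..n}" using block_point_bounds(2,3)[OF x s] subsetD[OF S(2) s] by simp
      then show "block ?S s \<in> orbit \<rho> ` {1..n}" using orb[OF s] by blast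
    qed
  qed
  also have "\<dots> = (\<lambda>i. {partial_sum \<mu> i <.. partial_sum \<mu> (Suc i)}) ` {..<length \<mu>}"
    unfolding partial_sums_eq image_image
    by (intro image_cong refl) (simp add: block_partial_sums[OF pos] flip: partial_sums_eq)
  finally have "cycle_type n \<rho> =
      image_mset card (mset_set ((\<lambda>i. {partial_sum \<mu> i <.. partial_sum \<mu> (Suc i)}) ` {..<length \<mu>}))"
    by (simp only: cycle_type_def)
  also have "\<dots> = image_mset (\<lambda>i. card {partial_sum \<mu> i <.. partial_sum \<mu> (Suc i)}) (mset_set {..<length \<mu>})"
  proof -
    have less: "partial_sum \<mu> i < partial_sum \<mu> (Suc i)" if "i < length \<mu>" for i
      using partial_sum_strict_mono[OF pos, of i "Suc i"] that by simp
    \<comment> \<open>Equal parts still give different blocks, so passing from the set of blocks to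
      the list of parts loses no multiplicity.\<close>
    have "inj_on (\<lambda>i. {partial_sum \<mu> i <.. partial_sum \<mu> (Suc i)}) {..<length \<mu>}"
    proof (rule linorder_inj_onI')
      fix i j assume ij: "i \<in> {..<length \<mu>}" "j \<in> {..<length \<mu>}" "i < j"
      have "partial_sum \<mu> (Suc i) \<in> {partial_sum \<mu> i <.. partial_sum \<mu> (Suc i)}" using less ij by simp
      moreover have "partial_sum \<mu> (Suc i) \<le> partial_sum \<mu> j"
        using partial_sum_strict_mono[OF pos, of "Suc i" j] ij by (cases "Suc i = j") auto
      ultimately show "{partial_sum \<mu> i <.. partial_sum \<mu> (Suc i)} \<noteq> {partial_sum \<mu> j <.. partial_sum \<mu> (Suc j)}"
        by (metis greaterThanAtMost_iff leD)
    qed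
    then show ?thesis by (simp add: image_mset_mset_set[symmetric] multiset.map_comp o_def)
  qed
  also have "\<dots> = image_mset ((!) \<mu>) (mset_set {..<length \<mu>})"
    by (intro image_mset_cong) (auto simp: partial_sum_Suc)
  also have "\<dots> = mset (map ((!) \<mu>) [0..<length \<mu>])"
    by (simp only: mset_map mset_upt atLeast0LessThan)
  also have "\<dots> = mset \<mu>" by (simp only: map_nth)
  finally show ?thesis .
qed

section \<open>Evaluation of the constant and the exponent \<open>k = 0\<close>\<close>

lemma ex_common_exponent: "\<exists>K>0. \<forall>\<sigma>\<in>symm_perms n. \<sigma> ^^ K = id"
proof -
  have "\<exists>m>0. \<sigma> ^^ m = id" if "\<sigma> \<in> symm_perms n" for \<sigma>
    using permutation_is_nilpotent[of \<sigma>] that by (auto simp: symm_perms_def permutation_permutes)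
  then obtain m where m: "\<And>\<sigma>. \<sigma> \<in> symm_perms n \<Longrightarrow> 0 < m \<sigma> \<and> \<sigma> ^^ m \<sigma> = id" by metis
  let ?K = "\<Prod>\<sigma>\<in>symm_perms n. m \<sigma>"
  have fin: "finite (symm_perms n)" unfolding symm_perms_def by (rule finite_permutations) simp
  have "\<sigma> ^^ ?K = id" if \<sigma>: "\<sigma> \<in> symm_perms n" for \<sigma>
  proof -
    obtain q where "?K = m \<sigma> * q" using dvd_prodI[OF fin \<sigma>, of m] by (rule dvdE)
    then show ?thesis using m[OF \<sigma>] by (simp add: funpow_mult[symmetric] id_funpow)
  qed
  moreover have "0 < ?K" using m by (intro prod_pos) simp
  ultimately show ?thesis by blast
qed

theorem theorem1p1:
  fixes n k :: nat and \<mu> :: "nat list" and \<pi> :: "nat \<Rightarrow> nat"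
  assumes "n \<ge> 1"
    and "integer_partition n \<mu>"
    and "\<pi> \<in> symm_perms n"
    and "cycle_type n \<pi> = mset \<mu>"
  shows "int (card {\<sigma> \<in> symm_perms n. \<sigma> ^^ k = \<pi>}) =
    (\<Sum>\<sigma> \<in> identity_roots n k \<inter> unimodal_perms n \<mu>.
       (- 1) ^ card (descent_set n \<sigma> - partial_sums \<mu>))"
proof -
  let ?S = "partial_sums \<mu>"
  let ?X = "block_points ?S"
  let ?rhs = "\<lambda>k. \<Sum>\<sigma> \<in> identity_roots n k \<inter> unimodal_perms n \<mu>.
       (- 1) ^ card (descent_set n \<sigma> - ?S) :: int"
  have pos: "\<forall>m\<in>set \<mu>. m > 0" and sum: "sum_list \<mu> = n"
    using assms(2) by (auto simp: integer_partition_def)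
  have \<pi>: "\<pi> permutes {1..n}" using assms(3) by (simp add: symm_perms_def)
  have total: "partial_sum \<mu> (length \<mu>) = n" using sum by (simp add: partial_sum_def)
  have "\<mu> \<noteq> []" using sum assms(1) by auto
  then have S1: "n \<in> ?S" unfolding partial_sums_def using total
    by (intro image_eqI[of _ _ "length \<mu>"]) (auto simp: Suc_le_eq)
  have S2: "?S \<subseteq> {1..n}"
  proof
    fix s assume "s \<in> ?S"
    then obtain i where i: "i \<in> {1..length \<mu>}" "s = partial_sum \<mu> i" unfolding partial_sums_def by blast
    have "0 < s" using partial_sum_strict_mono[OF pos, of 0 i] i by simp
    moreover have "s \<le> n"
      using partial_sum_strict_mono[OF pos, of i "length \<mu>"] i total by (cases "i = length \<mu>") auto
    ultimately show "s \<in> {1..n}" by simp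
  qed
  \<comment> \<open>\<open>M\<close> counts choices of points together with a permutation that is
    cyclic on the blocks; it does not involve \<open>k\<close>.\<close>
  define M where "M = (\<Sum>x\<in>?X. card (block_cyclic_perms n ?S x))"
  \<comment> \<open>Every block-cyclic permutation is conjugate to \<open>\<pi>\<close> and so has
    as many \<open>k\<close>-th roots as \<open>\<pi>\<close>; the common sign
    \<open>(- 1) ^ card ?S\<close> cancels.\<close>
  have main: "int (card (prefix_stabilizer n ?S)) * ?rhs k =
      int (M * card {\<sigma> \<in> symm_perms n. \<sigma> ^^ k = \<pi>})" if k: "0 < k" for k
  proof -
    have roots: "card {\<sigma>. \<sigma> permutes {1..n} \<and> \<sigma> ^^ k \<in> block_cyclic_perms n ?S x} =
        card (block_cyclic_perms n ?S x) * card {\<sigma> \<in> symm_perms n. \<sigma> ^^ k = \<pi>}" if x: "x \<in> ?X" for x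
    proof -
      let ?C = "block_cyclic_perms n ?S x"
      have finC: "finite ?C"
        by (rule finite_subset[OF _ finite_prefix_stabilizer[of n ?S]]) (auto simp: block_cyclic_perms_def)
      have "{\<sigma>. \<sigma> permutes {1..n} \<and> \<sigma> ^^ k \<in> ?C} = (\<Union>\<rho>\<in>?C. {\<sigma>. \<sigma> permutes {1..n} \<and> \<sigma> ^^ k = \<rho>})" by blast
      also have "card \<dots> = (\<Sum>\<rho>\<in>?C. card {\<sigma>. \<sigma> permutes {1..n} \<and> \<sigma> ^^ k = \<rho>})"
      proof (rule card_UN_disjoint[OF finC])
        show "\<forall>\<rho>\<in>?C. finite {\<sigma>. \<sigma> permutes {1..n} \<and> \<sigma> ^^ k = \<rho>}"
          by (intro ballI finite_subset[OF _ finite_permutations[of "{1..n}"]]) auto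
      qed blast
      also have "\<dots> = (\<Sum>\<rho>\<in>?C. card {\<sigma>. \<sigma> permutes {1..n} \<and> \<sigma> ^^ k = \<pi>})"
      proof (rule sum.cong[OF refl])
        fix \<rho> assume \<rho>: "\<rho> \<in> ?C"
        have "\<rho> permutes {1..n}" using \<rho> by (simp add: block_cyclic_perms_def prefix_stabilizer_def)
        then show "card {\<sigma>. \<sigma> permutes {1..n} \<and> \<sigma> ^^ k = \<rho>} = card {\<sigma>. \<sigma> permutes {1..n} \<and> \<sigma> ^^ k = \<pi>}"
          by (rule card_roots_cong_cycle_type[OF \<pi>])
            (simp only: assms(4) cycle_type_block_cyclic[OF pos S1 S2 x \<rho>])
      qed
      finally show ?thesis by (simp add: symm_perms_def)
    qed
    have "(\<Sum>x\<in>?X. int (card {\<sigma>. \<sigma> permutes {1..n} \<and> \<sigma> ^^ k \<in> block_cyclic_perms n ?S x})) =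
        int (M * card {\<sigma> \<in> symm_perms n. \<sigma> ^^ k = \<pi>})"
      unfolding M_def sum_distrib_right of_nat_sum by (intro sum.cong refl) (simp only: roots)
    with signed_descent_sum_identity[OF S1 S2 k]
    have "(- 1) ^ card ?S * (int (card (prefix_stabilizer n ?S)) * ?rhs k) =
        (- 1) ^ card ?S * int (M * card {\<sigma> \<in> symm_perms n. \<sigma> ^^ k = \<pi>})"
      unfolding signed_descent_sum_partial_sums[OF pos S1 S2] by (simp only: mult.left_commute)
    then show ?thesis by simp
  qed
  \<comment> \<open>For \<open>k = 1\<close> the root count and the signed sum both equal 1.\<close>
  have "M = card (prefix_stabilizer n ?S)"
  proof -
    \<comment> \<open>The identity increases on every block, so the minimum is at the first
      position, \<open>l = 1\<close>.\<close>
    have "id \<in> unimodal_perms n \<mu>"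
      unfolding unimodal_perms_def symm_perms_def using pos
      by (auto simp: permutes_id intro!: bexI[of _ 1] simp: Suc_le_eq)
    then have "identity_roots n 1 \<inter> unimodal_perms n \<mu> = {id}"
      by (auto simp: identity_roots_def symm_perms_def permutes_id)
    moreover have "descent_set n id = {}" by (simp add: descent_set_def)
    moreover have "{\<sigma> \<in> symm_perms n. \<sigma> ^^ 1 = \<pi>} = {\<pi>}" using assms(3) by auto
    ultimately have "int (card (prefix_stabilizer n ?S)) = int M" using main[of 1] by simp
    then show ?thesis by simp
  qed
  moreover have "card (prefix_stabilizer n ?S) \<noteq> 0"
  proof -
    have "id \<in> prefix_stabilizer n ?S" by (simp add: prefix_stabilizer_def permutes_id)
    then show ?thesis using finite_prefix_stabilizer[of n ?S] by (metis card_eq_0_iff empty_iff)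
  qed
  ultimately have positive: "int (card {\<sigma> \<in> symm_perms n. \<sigma> ^^ k = \<pi>}) = ?rhs k" if "0 < k" for k
    using main[OF that] by simp
  show ?thesis
  proof (cases "k = 0")
    case False
    then show ?thesis using positive by simp
  next
    case True
    \<comment> \<open>Any common exponent \<open>K > 0\<close> of the symmetric group has the same roots as \<open>k = 0\<close>.\<close>
    obtain K where K: "0 < K" "\<And>\<sigma>. \<sigma> \<in> symm_perms n \<Longrightarrow> \<sigma> ^^ K = id"
      using ex_common_exponent by blast
    have "{\<sigma> \<in> symm_perms n. \<sigma> ^^ k = \<pi>} = {\<sigma> \<in> symm_perms n. \<sigma> ^^ K = \<pi>}"
      using K(2) True by auto
    moreover have "identity_roots n k = identity_roots n K"
      using K(2) True by (auto simp: identity_roots_def)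
    ultimately show ?thesis using positive[OF K(1)] by simp
  qed
qed

end
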